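(* Let $\mathbb{M}$ be a complete MV-chain. All functions below, between spaces $\mathbb{M}^Y$ and $\mathbb{M}^Z$ with $Y,Z$ finite, are non-expansive, and for every $a$ in the domain their approximations $f_a^{\#}:\mathbf{2}^{[Y]_a}\to\mathbf{2}^{[Z]_{f(a)}}$ and $f^a_{\#}:\mathbf{2}^{[Y]^a}\to\mathbf{2}^{[Z]^{f(a)}}$ are as follows ($Y'$ ranges over subsets of $[Y]_a$ in the case of $f_a^{\#}$, of $[Y]^a$ in the case of $f^a_{\#}$): (1) Constant: for $k\in\mathbb{M}^Z$, $c_k(a)=k$: $(c_k)_a^{\#}(Y')=\emptyset=(c_k)^a_{\#}(Y')$. (2) Reindexing: for $u:Z\to Y$, $u^*(a)=a\circ u$: $(u^* )_a^{\#}(Y')=u^{-1}(Y')=(u^* )^a_{\#}(Y')$. (3) Minimum: for $\mathcal{R}\subseteq Y\times Z$, $f=\min_{\mathcal{R}}$, $f(a)(z)=\min_{y\mathcal{R}z}a(y)$: $f_a^{\#}(Y')=\{z\in[Z]_{f(a)}\mid\arg\min_{y\in\mathcal{R}^{-1}(z)}a(y)\subseteq Y'\}$ and $f^a_{\#}(Y')=\{z\in[Z]^{f(a)}\mid\arg\min_{y\in\mathcal{R}^{-1}(z)}a(y)\cap Y'\neq\emptyset\}$. (4) Maximum: for $\mathcal{R}\subseteq Y\times Z$, $f=\max_{\mathcal{R}}$, $f(a)(z)=\max_{y\mathcal{R}z}a(y)$: $f_a^{\#}(Y')=\{z\in[Z]_{f(a)}\mid\arg\max_{y\in\mathcal{R}^{-1}(z)}a(y)\cap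 Y'\neq\emptyset\}$ and $f^a_{\#}(Y')=\{z\in[Z]^{f(a)}\mid\arg\max_{y\in\mathcal{R}^{-1}(z)}a(y)\subseteq Y'\}$. (5) Average: suppose $\mathbb{M}$ is endowed with an operation $\odot$ as in the context, $Y\neq\emptyset$, $D\subseteq\mathcal{D}(Y)$ is finite, $Z=D$, $f=\mathrm{av}_D$, $f(a)(p)=\bigoplus_{y\in Y}p(y)\odot a(y)$: $f_a^{\#}(Y')=\{p\in[D]_{f(a)}\mid\mathrm{supp}(p)\subseteq Y'\}$ and $f^a_{\#}(Y')=\{p\in[D]^{f(a)}\mid\mathrm{supp}(p)\subseteq Y'\}$. Furthermore, non-expansive functions are closed under composition and disjoint union: (6) Composition: if $g:\mathbb{M}^Y\to\mathbb{M}^W$, $h:\mathbb{M}^W\to\mathbb{M}^Z$ ($W$ finite) are non-expansive, so is $h\circ g$, and $(h\circ g)_a^{\#}=h_{g(a)}^{\#}\circ g_a^{\#}$, $(h\circ g)^a_{\#}=h^{g(a)}_{\#}\circ g^a_{\#}$. (7) Disjoint union: let $I$ be finite and let $f_i:\mathbb{M}^{Y_i}\to\mathbb{M}^{Z_i}$ ($i\in I$; $Y_i,Z_i$ finite) be non-expansive with the $Z_i$ pairwise disjoint; let $Y=\bigcup_{i\in I}Y_i$, $Z=\biguplus_{i\in I}Z_i$. Then $\biguplus_{i\in I}f_i:\mathbb{M}^Y\to\mathbb{M}^Z$, $(\biguplus_{i\in I}f_i)(a)(z)=f_i(a|_{Y_i})(z)$ for $z\in Z_i$, is non-expansive, and $(\biguplus_{i\in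 I}f_i)_a^{\#}(Y')=\biguplus_{i\in I}(f_i)_{a|_{Y_i}}^{\#}(Y'\cap Y_i)$, $(\biguplus_{i\in I}f_i)^a_{\#}(Y')=\biguplus_{i\in I}(f_i)^{a|_{Y_i}}_{\#}(Y'\cap Y_i)$.
   Context: MV-algebras: an MV-algebra is a tuple $\mathbb{M}=(M,\oplus,0,\overline{(\cdot)})$ where $(M,\oplus,0)$ is a commutative monoid and $\overline{(\cdot)}:M\to M$ satisfies $\overline{\overline{x}}=x$, $x\oplus\overline{0}=\overline{0}$ and $\overline{(\overline{x}\oplus y)}\oplus y=\overline{(\overline{y}\oplus x)}\oplus x$ for all $x,y$. Put $1=\overline{0}$, $x\otimes y=\overline{\overline{x}\oplus\overline{y}}$, $x\ominus y=x\otimes\overline{y}$. The natural order is $x\sqsubseteq y$ iff $x\oplus z=y$ for some $z$; it is a lattice order with bottom $0$ and top $1$. $\mathbb{M}$ is an MV-chain if $\sqsubseteq$ is total, and complete if $(M,\sqsubseteq)$ is a complete lattice. Throughout $\min\emptyset=1$, $\max\emptyset=0$, and an empty $\bigoplus$ is $0$. Function spaces: $\mathbb{M}^Y$ is the set of functions $Y\to M$ with pointwise order and operations. For $Y'\subseteq Y$, $\delta\in\mathbb{M}$, $\delta_{Y'}$ is the function with value $\delta$ on $Y'$ and $0$ elsewhere. The norm is $\|a\|=\max\{a(y)\mid y\in Y\}$. A function $f:\mathbb{M}^Y\to\mathbb{M}^Z$ is non-expansive if $\|f(b)\ominus f(a)\|\sqsubseteq\|b\ominus a\|$ for all $a,b\in\mathbb{M}^Y$.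 Primal approximation: $[Y]_a=\{y\in Y\mid a(y)\neq 1\}$, $\delta_a=\min\{\overline{a(y)}\mid y\in[Y]_a\}$. For non-expansive $f$, $\delta\in\mathbb{M}$ and $Y'\subseteq[Y]_a$, $f_{a,\delta}^{\#}(Y')=\{z\in[Z]_{f(a)}\mid f(a\oplus\delta_{Y'})(z)\ominus f(a)(z)\sqsupseteq\delta\}$. Let $\iota_a^f(Y',z)=\max\{\theta\in\mathbb{M}\mid z\in f_{a,\theta}^{\#}(Y')\}$ for $z\in[Z]_{f(a)}$, $\iota_a^f=\min\big(\{\iota_a^f(Y',z)\mid Y'\subseteq[Y]_a,z\in[Z]_{f(a)},\iota_a^f(Y',z)\neq0\}\cup\{\delta_a\}\big)$, and $f_a^{\#}=f_{a,\iota_a^f}^{\#}$. Dual approximation: $[Y]^a=\{y\in Y\mid a(y)\neq 0\}$, $\delta^a=\min\{a(y)\mid y\in[Y]^a\}$. For $\delta\in\mathbb{M}$ and $Y'\subseteq[Y]^a$, $f^{a,\delta}_{\#}(Y')=\{z\in[Z]^{f(a)}\mid f(a)(z)\ominus f(a\ominus\delta_{Y'})(z)\sqsupseteq\delta\}$. Let $\iota^a_f(Y',z)=\max\{\theta\in\mathbb{M}\mid z\in f^{a,\theta}_{\#}(Y')\}$ for $z\in[Z]^{f(a)}$, $\iota^a_f=\min\big(\{\iota^a_f(Y',z)\mid Y'\subseteq[Y]^a,z\in[Z]^{f(a)},\iota^a_f(Y',z)\neq0\}\cup\{\delta^a\}\big)$, and $f^a_{\#}=f^{a,\iota^a_f}_{\#}$.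 Notation: $\mathcal{R}^{-1}(z)=\{y\in Y\mid y\mathcal{R}z\}$; $\arg\min_{y\in Y''}a(y)$ (resp. $\arg\max$) is the set of elements of $Y''$ where $a|_{Y''}$ attains its minimum (resp. maximum). Averages: a distribution on $Y$ is $p:Y\to\mathbb{M}$ with $\overline{p(y)}=\bigoplus_{y'\in Y\setminus\{y\}}p(y')$ for all $y\in Y$; $\mathcal{D}(Y)$ is the set of distributions; $\mathrm{supp}(p)=\{y\mid p(y)\neq0\}$. The operation $\odot$ on $\mathbb{M}$ is such that $(\mathbb{M},\odot,1)$ is a commutative monoid, $x\odot y\sqsubseteq x$, $x\odot y=0$ iff $x=0$ or $y=0$, and $x\odot(y\oplus z)=(x\odot y)\oplus(x\odot z)$ whenever $y\sqsubseteq\overline{z}$. *)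

theory Defs
  imports Main "HOL-Library.FuncSet" "HOL-Library.Disjoint_Sets"
begin

text \<open>
  An MV-algebra \<open>(M, \<oplus>, 0, \<sim>)\<close>: the monoid \<open>(M, \<oplus>, 0)\<close> is written \<open>(+)\<close>, \<open>0\<close>, so that
  \<open>\<Sum>\<close> is the finite iteration of \<open>\<oplus>\<close>.
\<close>

class mv_algebra = comm_monoid_add +
  fixes mv_neg :: "'a \<Rightarrow> 'a"  (\<open>\<sim> _\<close> [81] 80)
  assumes mv_neg_neg: "\<sim> (\<sim> x) = x"
    and mv_add_neg_zero: "x + \<sim> 0 = \<sim> 0"
    and mv_add_neg_swap: "\<sim> (\<sim> x + y) + y = \<sim> (\<sim> y + x) + x"

definition mv_one :: "'m::mv_algebra" where
  "mv_one = \<sim> 0"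

definition mv_times :: "'m::mv_algebra \<Rightarrow> 'm \<Rightarrow> 'm"  (infixl \<open>\<otimes>\<close> 70) where
  "x \<otimes> y = \<sim> (\<sim> x + \<sim> y)"

definition mv_minus :: "'m::mv_algebra \<Rightarrow> 'm \<Rightarrow> 'm"  (infixl \<open>\<ominus>\<close> 65) where
  "x \<ominus> y = x \<otimes> \<sim> y"

text \<open>
  In a complete MV-chain, \<open>(\<le>)\<close> is the natural order; it is required to be total and a
  complete lattice.
\<close>

class complete_mv_chain = mv_algebra + complete_linorder +
  assumes natural_order: "x \<le> y \<longleftrightarrow> (\<exists>z. x + z = y)"

text \<open>
  Minimum and maximum as least and greatest element (not merely infimum and supremum), with
  \<open>min \<emptyset> = 1\<close> and \<open>max \<emptyset> = 0\<close>.
\<close>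

definition mv_min :: "'m::complete_mv_chain set \<Rightarrow> 'm" where
  "mv_min A = (if A = {} then mv_one else (LEAST x. x \<in> A))"

definition mv_max :: "'m::complete_mv_chain set \<Rightarrow> 'm" where
  "mv_max A = (if A = {} then 0 else (GREATEST x. x \<in> A))"

text \<open>
  The elements of \<open>M\<^sup>Y\<close> are the functions that are extensional on \<open>Y\<close>; a map from \<open>M\<^sup>Y\<close> to \<open>M\<^sup>Z\<close>
  is a HOL function of which only the values on \<open>mv_space Y\<close> matter.
\<close>

abbreviation mv_space :: "'y set \<Rightarrow> ('y \<Rightarrow> 'm::complete_mv_chain) set" where
  "mv_space Y \<equiv> Y \<rightarrow>\<^sub>E UNIV"

definition fun_add :: "'y set \<Rightarrow> ('y \<Rightarrow> 'm::complete_mv_chain) \<Rightarrow> ('y \<Rightarrow> 'm) \<Rightarrow> ('y \<Rightarrow> 'm)" where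
  "fun_add Y a b = (\<lambda>y\<in>Y. a y + b y)"

definition fun_diff :: "'y set \<Rightarrow> ('y \<Rightarrow> 'm::complete_mv_chain) \<Rightarrow> ('y \<Rightarrow> 'm) \<Rightarrow> ('y \<Rightarrow> 'm)" where
  "fun_diff Y a b = (\<lambda>y\<in>Y. a y \<ominus> b y)"

definition step_fun :: "'y set \<Rightarrow> 'm::complete_mv_chain \<Rightarrow> 'y set \<Rightarrow> ('y \<Rightarrow> 'm)" where
  "step_fun Y \<delta> Y' = (\<lambda>y\<in>Y. if y \<in> Y' then \<delta> else 0)"

definition mv_norm :: "'y set \<Rightarrow> ('y \<Rightarrow> 'm::complete_mv_chain) \<Rightarrow> 'm" where
  "mv_norm Y a = mv_max {a y | y. y \<in> Y}"

definition non_expansive ::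
    "'y set \<Rightarrow> 'z set \<Rightarrow> (('y \<Rightarrow> 'm::complete_mv_chain) \<Rightarrow> ('z \<Rightarrow> 'm)) \<Rightarrow> bool" where
  "non_expansive Y Z f \<longleftrightarrow> f \<in> mv_space Y \<rightarrow> mv_space Z \<and>
     (\<forall>a\<in>mv_space Y. \<forall>b\<in>mv_space Y.
        mv_norm Z (fun_diff Z (f b) (f a)) \<le> mv_norm Y (fun_diff Y b a))"

text \<open>Primal approximation: \<open>non_one Y a\<close> is \<open>[Y]\<^sub>a\<close> and \<open>primal Y Z f a\<close> is \<open>f\<^sub>a\<^sup>#\<close>.\<close>

definition non_one :: "'y set \<Rightarrow> ('y \<Rightarrow> 'm::complete_mv_chain) \<Rightarrow> 'y set" where
  "non_one Y a = {y \<in> Y. a y \<noteq> mv_one}"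

definition primal_gap :: "'y set \<Rightarrow> ('y \<Rightarrow> 'm::complete_mv_chain) \<Rightarrow> 'm" where
  "primal_gap Y a = mv_min {\<sim> (a y) | y. y \<in> non_one Y a}"

definition primal_at ::
    "'y set \<Rightarrow> 'z set \<Rightarrow> (('y \<Rightarrow> 'm::complete_mv_chain) \<Rightarrow> ('z \<Rightarrow> 'm)) \<Rightarrow>
     ('y \<Rightarrow> 'm) \<Rightarrow> 'm \<Rightarrow> 'y set \<Rightarrow> 'z set" where
  "primal_at Y Z f a \<delta> Y' =
     {z \<in> non_one Z (f a). \<delta> \<le> f (fun_add Y a (step_fun Y \<delta> Y')) z \<ominus> f a z}"

definition primal_iota_at ::
    "'y set \<Rightarrow> 'z set \<Rightarrow> (('y \<Rightarrow> 'm::complete_mv_chain) \<Rightarrow> ('z \<Rightarrow> 'm)) \<Rightarrow>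
     ('y \<Rightarrow> 'm) \<Rightarrow> 'y set \<Rightarrow> 'z \<Rightarrow> 'm" where
  "primal_iota_at Y Z f a Y' z = mv_max {\<theta>. z \<in> primal_at Y Z f a \<theta> Y'}"

definition primal_iota ::
    "'y set \<Rightarrow> 'z set \<Rightarrow> (('y \<Rightarrow> 'm::complete_mv_chain) \<Rightarrow> ('z \<Rightarrow> 'm)) \<Rightarrow> ('y \<Rightarrow> 'm) \<Rightarrow> 'm" where
  "primal_iota Y Z f a =
     mv_min ({primal_iota_at Y Z f a Y' z | Y' z.
                Y' \<subseteq> non_one Y a \<and> z \<in> non_one Z (f a) \<and> primal_iota_at Y Z f a Y' z \<noteq> 0}
             \<union> {primal_gap Y a})"

definition primal ::
    "'y set \<Rightarrow> 'z set \<Rightarrow> (('y \<Rightarrow> 'm::complete_mv_chain) \<Rightarrow> ('z \<Rightarrow> 'm)) \<Rightarrow>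
     ('y \<Rightarrow> 'm) \<Rightarrow> 'y set \<Rightarrow> 'z set" where
  "primal Y Z f a = primal_at Y Z f a (primal_iota Y Z f a)"

text \<open>Dual approximation: \<open>non_zero Y a\<close> is \<open>[Y]\<^sup>a\<close> and \<open>dual Y Z f a\<close> is \<open>f\<^sup>a\<^sub>#\<close>.\<close>

definition non_zero :: "'y set \<Rightarrow> ('y \<Rightarrow> 'm::complete_mv_chain) \<Rightarrow> 'y set" where
  "non_zero Y a = {y \<in> Y. a y \<noteq> 0}"

definition dual_gap :: "'y set \<Rightarrow> ('y \<Rightarrow> 'm::complete_mv_chain) \<Rightarrow> 'm" where
  "dual_gap Y a = mv_min {a y | y. y \<in> non_zero Y a}"

definition dual_at ::
    "'y set \<Rightarrow> 'z set \<Rightarrow> (('y \<Rightarrow> 'm::complete_mv_chain) \<Rightarrow> ('z \<Rightarrow> 'm)) \<Rightarrow>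
     ('y \<Rightarrow> 'm) \<Rightarrow> 'm \<Rightarrow> 'y set \<Rightarrow> 'z set" where
  "dual_at Y Z f a \<delta> Y' =
     {z \<in> non_zero Z (f a). \<delta> \<le> f a z \<ominus> f (fun_diff Y a (step_fun Y \<delta> Y')) z}"

definition dual_iota_at ::
    "'y set \<Rightarrow> 'z set \<Rightarrow> (('y \<Rightarrow> 'm::complete_mv_chain) \<Rightarrow> ('z \<Rightarrow> 'm)) \<Rightarrow>
     ('y \<Rightarrow> 'm) \<Rightarrow> 'y set \<Rightarrow> 'z \<Rightarrow> 'm" where
  "dual_iota_at Y Z f a Y' z = mv_max {\<theta>. z \<in> dual_at Y Z f a \<theta> Y'}"

definition dual_iota ::
    "'y set \<Rightarrow> 'z set \<Rightarrow> (('y \<Rightarrow> 'm::complete_mv_chain) \<Rightarrow> ('z \<Rightarrow> 'm)) \<Rightarrow> ('y \<Rightarrow> 'm) \<Rightarrow> 'm" where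
  "dual_iota Y Z f a =
     mv_min ({dual_iota_at Y Z f a Y' z | Y' z.
                Y' \<subseteq> non_zero Y a \<and> z \<in> non_zero Z (f a) \<and> dual_iota_at Y Z f a Y' z \<noteq> 0}
             \<union> {dual_gap Y a})"

definition dual ::
    "'y set \<Rightarrow> 'z set \<Rightarrow> (('y \<Rightarrow> 'm::complete_mv_chain) \<Rightarrow> ('z \<Rightarrow> 'm)) \<Rightarrow>
     ('y \<Rightarrow> 'm) \<Rightarrow> 'y set \<Rightarrow> 'z set" where
  "dual Y Z f a = dual_at Y Z f a (dual_iota Y Z f a)"

definition const_map :: "('z \<Rightarrow> 'm::complete_mv_chain) \<Rightarrow> ('y \<Rightarrow> 'm) \<Rightarrow> ('z \<Rightarrow> 'm)" where
  "const_map k = (\<lambda>a. k)"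

definition reindex :: "'z set \<Rightarrow> ('z \<Rightarrow> 'y) \<Rightarrow> ('y \<Rightarrow> 'm::complete_mv_chain) \<Rightarrow> ('z \<Rightarrow> 'm)" where
  "reindex Z u a = (\<lambda>z\<in>Z. a (u z))"

definition min_rel ::
    "'z set \<Rightarrow> ('y \<times> 'z) set \<Rightarrow> ('y \<Rightarrow> 'm::complete_mv_chain) \<Rightarrow> ('z \<Rightarrow> 'm)" where
  "min_rel Z R a = (\<lambda>z\<in>Z. mv_min {a y | y. (y, z) \<in> R})"

definition max_rel ::
    "'z set \<Rightarrow> ('y \<times> 'z) set \<Rightarrow> ('y \<Rightarrow> 'm::complete_mv_chain) \<Rightarrow> ('z \<Rightarrow> 'm)" where
  "max_rel Z R a = (\<lambda>z\<in>Z. mv_max {a y | y. (y, z) \<in> R})"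

definition arg_min_set :: "('y \<Rightarrow> 'm::complete_mv_chain) \<Rightarrow> 'y set \<Rightarrow> 'y set" where
  "arg_min_set a S = {y. is_arg_min a (\<lambda>y. y \<in> S) y}"

definition arg_max_set :: "('y \<Rightarrow> 'm::complete_mv_chain) \<Rightarrow> 'y set \<Rightarrow> 'y set" where
  "arg_max_set a S = {y. is_arg_max a (\<lambda>y. y \<in> S) y}"

definition distributions :: "'y set \<Rightarrow> ('y \<Rightarrow> 'm::complete_mv_chain) set" where
  "distributions Y = {p \<in> mv_space Y. \<forall>y\<in>Y. \<sim> (p y) = (\<Sum>y'\<in>Y - {y}. p y')}"

definition supp :: "'y set \<Rightarrow> ('y \<Rightarrow> 'm::complete_mv_chain) \<Rightarrow> 'y set" where
  "supp Y p = {y \<in> Y. p y \<noteq> 0}"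

locale mv_product = comm_monoid prd mv_one
  for prd :: "'m::complete_mv_chain \<Rightarrow> 'm \<Rightarrow> 'm"  (infixl \<open>\<odot>\<close> 70) +
  assumes prd_le: "x \<odot> y \<le> x"
    and prd_eq_zero_iff: "x \<odot> y = 0 \<longleftrightarrow> x = 0 \<or> y = 0"
    and prd_add: "y \<le> \<sim> z \<Longrightarrow> x \<odot> (y + z) = x \<odot> y + x \<odot> z"

definition average ::
    "('m \<Rightarrow> 'm \<Rightarrow> 'm) \<Rightarrow> 'y set \<Rightarrow> ('y \<Rightarrow> 'm) set \<Rightarrow>
     ('y \<Rightarrow> 'm::complete_mv_chain) \<Rightarrow> (('y \<Rightarrow> 'm) \<Rightarrow> 'm)" where
  "average prd Y D a = (\<lambda>p\<in>D. \<Sum>y\<in>Y. prd (p y) (a y))"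

text \<open>
  The sets \<open>Zs i\<close> are meant to be pairwise disjoint, so that the index selected by \<open>THE\<close> is the
  unique \<open>i\<close> with \<open>z \<in> Zs i\<close>.
\<close>

definition disjoint_union_map ::
    "'i set \<Rightarrow> ('i \<Rightarrow> 'y set) \<Rightarrow> ('i \<Rightarrow> 'z set) \<Rightarrow>
     ('i \<Rightarrow> ('y \<Rightarrow> 'm::complete_mv_chain) \<Rightarrow> ('z \<Rightarrow> 'm)) \<Rightarrow> ('y \<Rightarrow> 'm) \<Rightarrow> ('z \<Rightarrow> 'm)" where
  "disjoint_union_map I Ys Zs fs a =
     (\<lambda>z\<in>(\<Union>i\<in>I. Zs i). let i = (THE i. i \<in> I \<and> z \<in> Zs i) in fs i (restrict a (Ys i)) z)"

end

theory Submission
  imports Defs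
begin

text \<open>
  For non-expansive \<open>f\<close> the set of steps \<open>\<theta>\<close> with \<open>z \<in> f\<^sup>#\<^sub>a\<^sub>,\<^sub>\<theta>(Y')\<close> is downward closed, so the threshold
  \<open>\<iota>\<close> disappears: \<open>z\<close> belongs to the approximation iff some positive step \<open>\<theta>\<close> on \<open>Y'\<close> makes
  \<open>f(a)(z)\<close> grow by at least \<open>\<theta>\<close>, and \<open>\<theta>\<close> may be taken as small as desired. With small steps each
  basic map is computed exactly, e.g. a minimum grows iff all its minimisers do. The dual
  approximation of \<open>f\<close> at \<open>a\<close> is the primal approximation of \<open>\<sim> f(\<sim> \<cdot>)\<close> at \<open>\<sim> a\<close>; this conjugation
  exchanges minimum and maximum and fixes reindexings and averages.
\<close>

section \<open>Arithmetic in complete MV-chains\<close>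

text \<open>Addition is truncated at \<open>mv_one\<close>, so it does not cancel:
  \<open>y + t \<le> x\<close> bounds the growth \<open>x \<ominus> y\<close> from below by
  \<open>t\<close> only when \<open>t \<le> \<sim> y\<close>. This shapes the treatment of the basic
  maps: steps are kept below \<open>\<sim> (f a z)\<close>, for averages also below
  \<open>\<sim> (a y)\<close>, and a sum is cancelled only after its summands are shown orthogonal,
  i.e. \<open>x \<le> \<sim> y\<close>. Non-expansiveness enters in the pointwise form that
  \<open>b \<le> a + t\<close> implies \<open>f b \<le> f a + t\<close>. Finiteness of the index
  sets makes \<open>primal_iota\<close> a minimum of finitely many positive values, hence positive;
  only the one-element algebra is an exception, and there \<open>non_one\<close> is empty.
  Composites and unions may have other thresholds than their components, so they are compared
  through arbitrary positive steps.\<close>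

lemma add_one [simp]: "x + mv_one = mv_one" for x :: "'m::mv_algebra"
  unfolding mv_one_def by (rule mv_add_neg_zero)

lemma one_add [simp]: "mv_one + x = mv_one" for x :: "'m::mv_algebra"
  unfolding add.commute[of mv_one] by (rule add_one)

text \<open>The swap axiom at \<open>mv_one\<close>: one side collapses to \<open>mv_one\<close>,
  the other to \<open>\<sim> x + x\<close>.\<close>

lemma add_neg_self: "x + \<sim> x = mv_one" for x :: "'m::mv_algebra"
proof -
  have "mv_one = \<sim> (\<sim> x + mv_one) + mv_one" by (rule add_one[symmetric])
  also have "\<dots> = \<sim> (\<sim> (\<sim> 0) + x) + x" unfolding mv_one_def by (rule mv_add_neg_swap)
  also have "\<dots> = \<sim> x + x" unfolding mv_neg_neg by simp
  finally show ?thesis unfolding add.commute[of x] by (rule sym)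
qed

lemma neg_neg [simp]: "\<sim> (\<sim> x) = x" for x :: "'m::mv_algebra"
  by (rule mv_neg_neg)

lemma neg_zero [simp]: "\<sim> 0 = (mv_one :: 'm::mv_algebra)"
  by (simp add: mv_one_def)

lemma neg_one [simp]: "\<sim> mv_one = (0 :: 'm::mv_algebra)"
  unfolding mv_one_def by (rule neg_neg)

lemma neg_eq_iff [simp]: "\<sim> x = \<sim> y \<longleftrightarrow> x = y" for x y :: "'m::mv_algebra"
  by (rule inj_eq[OF inj_on_inverseI]) (rule neg_neg)

lemma neg_eq_one_iff [simp]: "\<sim> x = mv_one \<longleftrightarrow> x = 0" for x :: "'m::mv_algebra"
  using neg_eq_iff[of x 0] unfolding neg_zero .

lemma neg_eq_zero_iff [simp]: "\<sim> x = 0 \<longleftrightarrow> x = mv_one" for x :: "'m::mv_algebra"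
  using neg_eq_iff[of x mv_one] unfolding neg_one .

section \<open>Order, truncated difference and residuation\<close>

lemma minus_eq: "x \<ominus> y = \<sim> (\<sim> x + y)" for x y :: "'m::mv_algebra"
  by (simp add: mv_minus_def mv_times_def)

\<comment> \<open>Gives access to the library on ordered monoids and their finite sums, e.g.
  \<open>add_mono\<close>, \<open>sum_mono\<close> and \<open>zero_le\<close>.\<close>
subclass (in complete_mv_chain) canonically_ordered_monoid_add
  by standard (metis natural_order)

lemma le_one [simp]: "x \<le> mv_one" for x :: "'m::complete_mv_chain"
  using add_neg_self natural_order by blast

lemma bot_eq_zero: "bot = (0 :: 'm::complete_mv_chain)"
  by (metis bot.extremum_uniqueI zero_le)

lemma top_eq_one: "top = (mv_one :: 'm::complete_mv_chain)"
  by (metis top.extremum_uniqueI le_one)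

lemma le_add_left [simp]: "x \<le> x + y" for x y :: "'m::complete_mv_chain"
  by (auto simp: natural_order)

lemma le_add_right [simp]: "x \<le> y + x" for x y :: "'m::complete_mv_chain"
  by (simp add: add.commute)

text \<open>Turns the order into an equation. For the converse, \<open>\<sim> x + y = mv_one\<close>
  reduces one side of the swap axiom to \<open>y\<close>, and the other side has the form
  \<open>x + z\<close>.\<close>

lemma le_iff_neg_add: "x \<le> y \<longleftrightarrow> \<sim> x + y = mv_one" for x y :: "'m::complete_mv_chain"
proof
  assume "x \<le> y"
  then obtain z where "y = x + z" by (auto simp: natural_order)
  then have "\<sim> x + y = (x + \<sim> x) + z" by (simp add: ac_simps)
  then show "\<sim> x + y = mv_one" by (simp add: add_neg_self)
next
  assume "\<sim> x + y = mv_one"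
  then have "y = x + \<sim> (\<sim> y + x)"
    using mv_add_neg_swap[of x y] by (metis add.commute add_0 neg_one)
  then show "x \<le> y" by (metis le_add_left)
qed

lemma neg_le_neg_iff [simp]: "\<sim> x \<le> \<sim> y \<longleftrightarrow> y \<le> x" for x y :: "'m::complete_mv_chain"
  by (simp add: le_iff_neg_add add.commute)

lemma le_neg_swap: "x \<le> \<sim> y \<longleftrightarrow> y \<le> \<sim> x" for x y :: "'m::complete_mv_chain"
  by (metis neg_le_neg_iff neg_neg)

text \<open>Residuation: both sides say \<open>\<sim> x + y + t = mv_one\<close>. Most facts on
  \<ominus> rest on this adjunction.\<close>

lemma minus_le_iff: "x \<ominus> y \<le> t \<longleftrightarrow> x \<le> y + t" for x y t :: "'m::complete_mv_chain"
  unfolding le_iff_neg_add minus_eq by (simp only: neg_neg add.assoc)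

lemma minus_mono: "x \<le> y \<Longrightarrow> x \<ominus> z \<le> y \<ominus> z" for x y z :: "'m::complete_mv_chain"
  by (metis minus_le_iff order_refl order_trans)

lemma minus_le_neg: "x \<ominus> y \<le> \<sim> y" for x y :: "'m::complete_mv_chain"
  by (simp add: minus_le_iff add_neg_self)

lemma minus_eq_zero_iff: "x \<ominus> y = 0 \<longleftrightarrow> x \<le> y" for x y :: "'m::complete_mv_chain"
  using minus_le_iff[of x y 0] by simp

lemma minus_self [simp]: "x \<ominus> x = 0" for x :: "'m::complete_mv_chain"
  by (simp add: minus_eq_zero_iff)

lemma minus_pos_iff: "0 < x \<ominus> y \<longleftrightarrow> y < x" for x y :: "'m::complete_mv_chain"
  using minus_le_iff[of x y 0] by (metis add_0_right le_zero_eq not_le zero_less_iff_neq_zero)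

text \<open>The swap axiom says precisely that the left side is symmetric in \<open>x\<close> and
  \<open>y\<close>; on a chain it is therefore enough to know its value when the difference
  vanishes.\<close>

lemma add_minus_eq_max: "y + (x \<ominus> y) = max x y" for x y :: "'m::complete_mv_chain"
proof (cases "x \<le> y")
  case True
  then have "x \<ominus> y = 0" using minus_le_iff[of x y 0] by simp
  with True show ?thesis by (simp add: max_def)
next
  case False
  then have "\<sim> y + x = mv_one" by (simp add: le_iff_neg_add[symmetric])
  then have "\<sim> (\<sim> x + y) + y = x" using mv_add_neg_swap[of x y] by simp
  with False show ?thesis by (simp add: minus_eq add.commute[of y] max_def)
qed

lemma add_minus_self: "y \<le> x \<Longrightarrow> y + (x \<ominus> y) = x" for x y :: "'m::complete_mv_chain"
  by (simp add: add_minus_eq_max)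

text \<open>The negated form of \<open>add_minus_eq_max\<close>. The minimum records the truncation:
  \<open>x\<close> is recovered from \<open>x + y\<close> only up to
  \<open>\<sim> y\<close>.\<close>

lemma minus_add_eq_min: "(x + y) \<ominus> y = min x (\<sim> y)" for x y :: "'m::complete_mv_chain"
proof -
  have "y + (\<sim> x \<ominus> y) = max (\<sim> x) y" by (rule add_minus_eq_max)
  then have "\<sim> (x + y) + y = max (\<sim> x) y" by (simp add: minus_eq add.commute)
  then have "(x + y) \<ominus> y = \<sim> (max (\<sim> x) y)" by (simp add: minus_eq)
  also have "\<dots> = min x (\<sim> y)"
    using le_neg_swap[of x y] neg_le_neg_iff[of x "\<sim> y"] by (auto simp: max_def min_def intro: antisym)
  finally show ?thesis .
qed

lemma minus_minus_eq_min: "x \<ominus> (x \<ominus> y) = min x y" for x y :: "'m::complete_mv_chain"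
proof (cases "y \<le> x")
  case True
  then have "x \<ominus> (x \<ominus> y) = (y + (x \<ominus> y)) \<ominus> (x \<ominus> y)" by (simp add: add_minus_self)
  also have "\<dots> = min y (\<sim> (x \<ominus> y))" by (rule minus_add_eq_min)
  also have "\<dots> = y" using minus_le_neg[of x y] by (simp add: le_neg_swap min_def)
  finally show ?thesis using True by (simp add: min_def antisym)
next
  case False
  then have "x \<ominus> y = 0" using minus_le_iff[of x y 0] by simp
  with False show ?thesis by (simp add: minus_eq min_def not_le order_less_imp_le)
qed

text \<open>Positivity forces \<open>y < x\<close>; with \<open>t = 0\<close> the premise would hold
  even for \<open>x < y\<close>, where the second conclusion fails.\<close>

lemma le_minusD:
  fixes x y t :: "'m::complete_mv_chain"
  assumes pos: "0 < t" and t: "t \<le> x \<ominus> y"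
  shows "t \<le> \<sim> y" and "y + t \<le> x"
proof -
  show "t \<le> \<sim> y" using t minus_le_neg order_trans by blast
  have "y < x" using pos t minus_pos_iff by (metis order_less_le_trans)
  then have "y + (x \<ominus> y) = x" by (intro add_minus_self) simp
  then show "y + t \<le> x"
    using add_mono[OF order_refl t, of y] by simp
qed

text \<open>The bound \<open>t \<le> \<sim> y\<close> excludes truncation of \<open>y + t\<close>:
  for \<open>x = y = mv_one\<close> the second premise holds for every \<open>t\<close>, although
  the difference is \<open>0\<close>.\<close>

lemma le_minusI:
  fixes x y t :: "'m::complete_mv_chain"
  assumes "t \<le> \<sim> y" and "y + t \<le> x"
  shows "t \<le> x \<ominus> y"
proof -
  have "t \<le> (t + y) \<ominus> y" using assms(1) by (simp add: minus_add_eq_min)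
  also have "\<dots> \<le> x \<ominus> y" using assms(2) by (intro minus_mono) (simp only: add.commute)
  finally show ?thesis .
qed

lemma neg_minus_neg: "\<sim> x \<ominus> \<sim> y = y \<ominus> x" for x y :: "'m::mv_algebra"
  by (simp add: minus_eq add.commute)

lemma neg_minus: "\<sim> (x \<ominus> y) = \<sim> x + y" for x y :: "'m::mv_algebra"
  by (simp add: minus_eq)

text \<open>For orthogonal summands \<open>(x + y) \<ominus> y\<close> gives back \<open>x\<close>,
  and here it is also \<open>y \<ominus> y\<close>.\<close>

lemma mv_add_cancel: "x \<le> \<sim> y \<Longrightarrow> x + y = y \<Longrightarrow> x = 0" for x y :: "'m::complete_mv_chain"
  using minus_add_eq_min[of x y] minus_le_iff[of y y 0] by (simp add: min_absorb1)

text \<open>Regroups an untruncated sum of three elements: \<open>x\<close> is recovered as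
  \<open>(x + y) \<ominus> y\<close>, and subtracting \<open>y\<close> from \<open>\<sim> z\<close>
  gives \<open>\<sim> (y + z)\<close>.\<close>

lemma orthogonal_assoc:
  fixes x y z :: "'m::complete_mv_chain"
  assumes "x \<le> \<sim> y" and "x + y \<le> \<sim> z"
  shows "x \<le> \<sim> (y + z)"
proof -
  have "x = (x + y) \<ominus> y" using assms(1) by (simp add: minus_add_eq_min min_absorb1)
  also have "\<dots> \<le> \<sim> z \<ominus> y" using assms(2) by (rule minus_mono)
  also have "\<dots> = \<sim> (y + z)" unfolding minus_eq by (simp only: neg_neg add.commute)
  finally show ?thesis .
qed

section \<open>Minima and maxima as infima and suprema\<close>

lemma mv_min_eq_Inf:
  fixes A :: "'m::complete_mv_chain set"
  assumes "finite A"
  shows "mv_min A = Inf A"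
proof (cases "A = {}")
  case False
  then have "\<exists>x. x \<in> A" by blast
  then have "(LEAST x. x \<in> A) = Min A" using Least_Min[of "\<lambda>x. x \<in> A"] assms by simp
  then show ?thesis using False assms by (simp add: mv_min_def Min_Inf)
qed (simp add: mv_min_def top_eq_one)

text \<open>Asks for attainment instead of finiteness, because the set of steps in
  \<open>primal_iota_at\<close> may be infinite.\<close>

lemma mv_max_eq_Sup: "Sup A \<in> A \<Longrightarrow> mv_max A = Sup A" for A :: "'m::complete_mv_chain set"
  by (auto simp: mv_max_def intro: Greatest_equality Sup_upper)

lemma mv_max_eq_Sup_finite:
  fixes A :: "'m::complete_mv_chain set"
  assumes "finite A"
  shows "mv_max A = Sup A"
proof (cases "A = {}")
  case False
  then show ?thesis using Max_in[OF assms] assms by (intro mv_max_eq_Sup) (simp add: Max_Sup)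
qed (simp add: mv_max_def bot_eq_zero)

text \<open>A finite infimum is attained. This yields the steps that are small enough for finitely
  many bounds at once.\<close>

lemma inf_pos:
  fixes S :: "'m::complete_mv_chain set"
  assumes "finite S" and "S \<noteq> {}" and "\<And>s. s \<in> S \<Longrightarrow> 0 < s"
  shows "0 < Inf S"
  using assms Min_in[of S] by (simp add: Min_Inf[symmetric])

section \<open>Non-expansive maps and their primal approximation\<close>

lemma fun_add_mem [simp]: "fun_add Y a b \<in> mv_space Y"
  by (simp add: fun_add_def)

lemma fun_diff_mem [simp]: "fun_diff Y a b \<in> mv_space Y"
  by (simp add: fun_diff_def)

lemma fun_add_step:
  "y \<in> Y \<Longrightarrow> fun_add Y a (step_fun Y \<delta> Y') y = (if y \<in> Y' then a y + \<delta> else a y)"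
  by (simp add: fun_add_def step_fun_def)

lemma mv_norm_le_iff: "finite Y \<Longrightarrow> mv_norm Y a \<le> t \<longleftrightarrow> (\<forall>y\<in>Y. a y \<le> t)"
  by (auto simp: mv_norm_def mv_max_eq_Sup_finite Sup_le_iff)

text \<open>By residuation the norm of \<open>b \<ominus> a\<close> is the least \<open>t\<close>
  with \<open>b y \<le> a y + t\<close> everywhere, so norms can be traded for a quantified
  \<open>t\<close>.\<close>

lemma non_expansiveI:
  fixes f :: "('y \<Rightarrow> 'm::complete_mv_chain) \<Rightarrow> ('z \<Rightarrow> 'm)"
  assumes "finite Y" "finite Z" and "f \<in> mv_space Y \<rightarrow> mv_space Z"
    and "\<And>a b t z. \<lbrakk>a \<in> mv_space Y; b \<in> mv_space Y; \<And>y. y \<in> Y \<Longrightarrow> b y \<le> a y + t; z \<in> Z\<rbrakk>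
           \<Longrightarrow> f b z \<le> f a z + t"
  shows "non_expansive Y Z f"
  unfolding non_expansive_def
proof (intro conjI ballI)
  fix a b :: "'y \<Rightarrow> 'm"
  assume ab: "a \<in> mv_space Y" "b \<in> mv_space Y"
  define t where "t = mv_norm Y (fun_diff Y b a)"
  have "b y \<le> a y + t" if "y \<in> Y" for y
    using mv_norm_le_iff[OF assms(1), of "fun_diff Y b a" t] that
    by (simp add: t_def fun_diff_def minus_le_iff)
  then have "f b z \<le> f a z + t" if "z \<in> Z" for z using assms(4) ab that by blast
  then show "mv_norm Z (fun_diff Z (f b) (f a)) \<le> t"
    by (simp add: mv_norm_le_iff[OF assms(2)] fun_diff_def minus_le_iff)
qed (fact assms(3))

lemma non_expansiveD:
  assumes "non_expansive Y Z f" "finite Y" "finite Z" "a \<in> mv_space Y" "b \<in> mv_space Y"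
    and le: "\<And>y. y \<in> Y \<Longrightarrow> b y \<le> a y + t" and "z \<in> Z"
  shows "f b z \<le> f a z + t"
proof -
  have "mv_norm Y (fun_diff Y b a) \<le> t"
    using le by (simp add: mv_norm_le_iff assms(2) fun_diff_def minus_le_iff)
  then have "mv_norm Z (fun_diff Z (f b) (f a)) \<le> t"
    using assms(1,4,5) unfolding non_expansive_def by (blast intro: order_trans)
  then show ?thesis
    using assms(7) by (simp add: mv_norm_le_iff assms(3) fun_diff_def minus_le_iff)
qed

lemma non_expansive_mem: "non_expansive Y Z f \<Longrightarrow> a \<in> mv_space Y \<Longrightarrow> f a \<in> mv_space Z"
  by (auto simp: non_expansive_def)

text \<open>The case \<open>t = 0\<close>: since the norm measures a one-sided difference,
  non-expansive maps are monotone.\<close>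

lemma non_expansive_mono:
  assumes "non_expansive Y Z f" "finite Y" "finite Z" "a \<in> mv_space Y" "b \<in> mv_space Y"
    and "\<And>y. y \<in> Y \<Longrightarrow> a y \<le> b y" and "z \<in> Z"
  shows "f a z \<le> f b z"
  using non_expansiveD[OF assms(1-3,5,4), of 0 z] assms(6,7) by simp

text \<open>Shrinking the step from \<delta> to \<theta> costs at most
  \<open>\<delta> \<ominus> \<theta>\<close> in the value of \<open>f\<close>, so the growth is
  still at least \<open>\<delta> \<ominus> (\<delta> \<ominus> \<theta>) = \<theta>\<close>.\<close>

lemma primal_at_antimono:
  assumes f: "non_expansive Y Z f" "finite Y" "finite Z" and a: "a \<in> mv_space Y"
    and "\<theta> \<le> \<delta>"
  shows "primal_at Y Z f a \<delta> Y' \<subseteq> primal_at Y Z f a \<theta> Y'"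
proof
  let ?s = "\<lambda>t. fun_add Y a (step_fun Y t Y')"
  fix z assume "z \<in> primal_at Y Z f a \<delta> Y'"
  then have z: "z \<in> non_one Z (f a)" "z \<in> Z" and le: "\<delta> \<le> f (?s \<delta>) z \<ominus> f a z"
    by (auto simp: primal_at_def non_one_def)
  have step: "?s \<delta> y \<le> ?s \<theta> y + (\<delta> \<ominus> \<theta>)" if "y \<in> Y" for y
    using that add_minus_self[OF \<open>\<theta> \<le> \<delta>\<close>] by (simp add: fun_add_step add.assoc)
  have "f (?s \<delta>) z \<le> f (?s \<theta>) z + (\<delta> \<ominus> \<theta>)"
    by (rule non_expansiveD[OF f]) (auto simp: z step)
  also have "\<dots> \<le> (f a z + (f (?s \<theta>) z \<ominus> f a z)) + (\<delta> \<ominus> \<theta>)"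
    by (intro add_mono) (simp_all add: add_minus_eq_max)
  finally have "f (?s \<delta>) z \<ominus> f a z \<le> (\<delta> \<ominus> \<theta>) + (f (?s \<theta>) z \<ominus> f a z)"
    by (simp add: minus_le_iff ac_simps)
  with le have "\<delta> \<ominus> (\<delta> \<ominus> \<theta>) \<le> f (?s \<theta>) z \<ominus> f a z"
    unfolding minus_le_iff[of \<delta>] by (rule order_trans)
  with \<open>\<theta> \<le> \<delta>\<close> have "\<theta> \<le> f (?s \<theta>) z \<ominus> f a z" by (simp add: minus_minus_eq_min min_absorb2)
  with z show "z \<in> primal_at Y Z f a \<theta> Y'" by (simp add: primal_at_def)
qed

text \<open>The maximum defining \<open>primal_iota_at\<close> really exists: by monotonicity the
  step \<open>Sup ?T\<close> produces at least the growth of every step in \<open>?T\<close>, hence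
  growth at least \<open>Sup ?T\<close>. With \<open>primal_at_antimono\<close>, the admissible
  steps form the initial segment below it.\<close>

lemma primal_at_iff_le_iota:
  assumes f: "non_expansive Y Z f" "finite Y" "finite Z" and a: "a \<in> mv_space Y"
    and z: "z \<in> non_one Z (f a)"
  shows "z \<in> primal_at Y Z f a \<theta> Y' \<longleftrightarrow> \<theta> \<le> primal_iota_at Y Z f a Y' z"
proof -
  let ?T = "{\<theta>. z \<in> primal_at Y Z f a \<theta> Y'}"
  let ?s = "\<lambda>t. fun_add Y a (step_fun Y t Y')"
  have zZ: "z \<in> Z" using z by (simp add: non_one_def)
  have "\<theta> \<le> f (?s (Sup ?T)) z \<ominus> f a z" if "\<theta> \<in> ?T" for \<theta>
  proof -
    have "\<theta> \<le> Sup ?T" using that by (rule Sup_upper)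
    then have "f (?s \<theta>) z \<le> f (?s (Sup ?T)) z"
      by (intro non_expansive_mono[OF f]) (auto simp: fun_add_step zZ intro: add_mono)
    then show ?thesis
      using that minus_mono order_trans unfolding primal_at_def by blast
  qed
  then have "Sup ?T \<le> f (?s (Sup ?T)) z \<ominus> f a z" by (rule Sup_least)
  then have Sup: "Sup ?T \<in> ?T" using z by (simp add: primal_at_def)
  then have "primal_iota_at Y Z f a Y' z = Sup ?T"
    unfolding primal_iota_at_def by (rule mv_max_eq_Sup)
  then show ?thesis
    using Sup primal_at_antimono[OF f a, of \<theta> "Sup ?T" Y'] Sup_upper[of \<theta> ?T] by auto
qed

lemma primal_gap_pos:
  assumes "finite Y" and "(0 :: 'm::complete_mv_chain) \<noteq> mv_one"
  shows "0 < primal_gap Y (a :: 'y \<Rightarrow> 'm)"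
proof (cases "non_one Y a = {}")
  case True
  \<comment> \<open>The gap is the default \<open>mv_one\<close> of an empty minimum here, which is
    positive because the algebra is not trivial.\<close>
  then show ?thesis using assms(2) by (simp add: primal_gap_def mv_min_def zero_less_iff_neq_zero eq_commute)
next
  case False
  have "finite (non_one Y a)" using assms(1) by (simp add: non_one_def)
  then have fin: "finite {\<sim> (a y) | y. y \<in> non_one Y a}" by simp
  show ?thesis
    unfolding primal_gap_def mv_min_eq_Inf[OF fin]
    using False fin by (intro inf_pos) (auto simp: zero_less_iff_neq_zero non_one_def)
qed

text \<open>Finitely many pairs of a subset and a point occur, so the minimum defining
  \<open>primal_iota\<close> is an infimum over a finite set of positive elements.\<close>

lemma
  fixes f :: "('y \<Rightarrow> 'm::complete_mv_chain) \<Rightarrow> ('z \<Rightarrow> 'm)"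
  assumes "finite Y" "finite Z"
  shows primal_iota_pos: "(0 :: 'm) \<noteq> mv_one \<Longrightarrow> 0 < primal_iota Y Z f a"
    and primal_iota_le: "Y' \<subseteq> non_one Y a \<Longrightarrow> z \<in> non_one Z (f a) \<Longrightarrow>
      primal_iota_at Y Z f a Y' z \<noteq> 0 \<Longrightarrow> primal_iota Y Z f a \<le> primal_iota_at Y Z f a Y' z"
proof -
  let ?A = "{primal_iota_at Y Z f a Y' z | Y' z.
    Y' \<subseteq> non_one Y a \<and> z \<in> non_one Z (f a) \<and> primal_iota_at Y Z f a Y' z \<noteq> 0}"
  have "?A \<subseteq> (\<lambda>(Y', z). primal_iota_at Y Z f a Y' z) ` (Pow (non_one Y a) \<times> non_one Z (f a))"
    by force
  moreover have "finite (Pow (non_one Y a) \<times> non_one Z (f a))"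
    using assms by (simp add: non_one_def)
  ultimately have fin: "finite (?A \<union> {primal_gap Y a})"
    by (meson finite_Un finite_imageI finite_subset finite.emptyI finite_insert)
  note eq = primal_iota_def[of Y Z f a, unfolded mv_min_eq_Inf[OF fin]]
  show "0 < primal_iota Y Z f a" if "(0 :: 'm) \<noteq> mv_one"
    unfolding eq using fin primal_gap_pos[OF assms(1) that, of a]
    by (intro inf_pos) (auto simp: zero_less_iff_neq_zero)
  show "primal_iota Y Z f a \<le> primal_iota_at Y Z f a Y' z"
    if "Y' \<subseteq> non_one Y a" "z \<in> non_one Z (f a)" "primal_iota_at Y Z f a Y' z \<noteq> 0"
    unfolding eq using that by (intro Inf_lower) blast
qed

text \<open>If some positive step works, then \<open>primal_iota_at\<close> is nonzero, hence takes
  part in the minimum and lies above \<open>primal_iota\<close>; conversely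
  \<open>primal_iota\<close> is itself a positive step.\<close>

lemma primal_iff_at:
  fixes f :: "('y \<Rightarrow> 'm::complete_mv_chain) \<Rightarrow> ('z \<Rightarrow> 'm)"
  assumes f: "non_expansive Y Z f" "finite Y" "finite Z" and a: "a \<in> mv_space Y"
    and Y': "Y' \<subseteq> non_one Y a"
  shows "z \<in> primal Y Z f a Y' \<longleftrightarrow> (\<exists>\<theta>>0. z \<in> primal_at Y Z f a \<theta> Y')"
proof (cases "z \<in> non_one Z (f a)")
  case True
  then have "f a z \<noteq> mv_one" by (simp add: non_one_def)
  then have nt: "(0 :: 'm) \<noteq> mv_one" by (metis le_one le_zero_eq)
  note at = primal_at_iff_le_iota[OF f a True]
  show ?thesis
  proof
    assume "z \<in> primal Y Z f a Y'"
    then show "\<exists>\<theta>>0. z \<in> primal_at Y Z f a \<theta> Y'"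
      using primal_iota_pos[OF f(2,3) nt] unfolding primal_def by blast
  next
    assume "\<exists>\<theta>>0. z \<in> primal_at Y Z f a \<theta> Y'"
    then have "primal_iota_at Y Z f a Y' z \<noteq> 0" by (metis at leD)
    then show "z \<in> primal Y Z f a Y'"
      unfolding primal_def at by (intro primal_iota_le f Y' True)
  qed
qed (auto simp: primal_def primal_at_def)

lemma primal_memI:
  assumes f: "non_expansive Y Z f" "finite Y" "finite Z" and a: "a \<in> mv_space Y"
    and Y': "Y' \<subseteq> non_one Y a" and z: "z \<in> non_one Z (f a)"
    and "0 < \<theta>" "\<theta> \<le> \<sim> (f a z)" "f a z + \<theta> \<le> f (fun_add Y a (step_fun Y \<theta> Y')) z"
  shows "z \<in> primal Y Z f a Y'"
  unfolding primal_iff_at[OF f a Y'] primal_at_def using assms(6-) by (blast intro: le_minusI)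

text \<open>The bound \<gamma> is at the caller's choice: by downward closure any witness can be cut
  down to it, which keeps truncation and competing values out of a computation.\<close>

lemma primal_memE:
  assumes f: "non_expansive Y Z f" "finite Y" "finite Z" and a: "a \<in> mv_space Y"
    and Y': "Y' \<subseteq> non_one Y a" and "z \<in> primal Y Z f a Y'" and "0 < \<gamma>"
  obtains \<theta> where "z \<in> non_one Z (f a)" "0 < \<theta>" "\<theta> \<le> \<gamma>" "\<theta> \<le> \<sim> (f a z)"
    "f a z + \<theta> \<le> f (fun_add Y a (step_fun Y \<theta> Y')) z"
proof -
  obtain \<theta> where \<theta>: "0 < \<theta>" "z \<in> primal_at Y Z f a \<theta> Y'"
    using primal_iff_at[OF f a Y'] assms(6) by blast
  let ?\<theta> = "min \<theta> \<gamma>"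
  have pos: "0 < ?\<theta>" using \<theta> \<open>0 < \<gamma>\<close> by simp
  have at: "z \<in> primal_at Y Z f a ?\<theta> Y'"
    using \<theta> primal_at_antimono[OF f a min.cobounded1] by blast
  show thesis
    by (rule that[of ?\<theta>]) (use pos at in \<open>auto simp: primal_at_def intro: le_minusD\<close>)
qed

text \<open>Only values on \<open>mv_space Y\<close> enter the definitions; conjugated maps are
  identified with known ones only there.\<close>

lemma primal_cong:
  assumes "\<And>a. a \<in> mv_space Y \<Longrightarrow> f a = g a" and "a \<in> mv_space Y"
  shows "primal Y Z f a = primal Y Z g a"
  using assms by (simp add: primal_def primal_iota_def primal_iota_at_def primal_at_def[abs_def])

lemma non_expansive_cong:
  assumes "\<And>a. a \<in> mv_space Y \<Longrightarrow> f a = g a"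
  shows "non_expansive Y Z f \<longleftrightarrow> non_expansive Y Z g"
  using assms by (simp add: non_expansive_def Pi_def)

section \<open>Duality\<close>

definition fun_neg :: "'y set \<Rightarrow> ('y \<Rightarrow> 'm::complete_mv_chain) \<Rightarrow> ('y \<Rightarrow> 'm)" where
  "fun_neg Y a = (\<lambda>y\<in>Y. \<sim> (a y))"

definition de_morgan ::
    "'y set \<Rightarrow> 'z set \<Rightarrow> (('y \<Rightarrow> 'm::complete_mv_chain) \<Rightarrow> ('z \<Rightarrow> 'm)) \<Rightarrow>
     ('y \<Rightarrow> 'm) \<Rightarrow> ('z \<Rightarrow> 'm)" where
  "de_morgan Y Z f a = fun_neg Z (f (fun_neg Y a))"

lemma fun_neg_mem [simp]: "fun_neg Y a \<in> mv_space Y"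
  by (simp add: fun_neg_def)

lemma fun_neg_app [simp]: "y \<in> Y \<Longrightarrow> fun_neg Y a y = \<sim> (a y)"
  by (simp add: fun_neg_def)

lemma fun_neg_neg [simp]: "a \<in> mv_space Y \<Longrightarrow> fun_neg Y (fun_neg Y a) = a"
  by (auto simp: fun_neg_def PiE_def extensional_def)

lemma non_one_fun_neg [simp]: "non_one Y (fun_neg Y a) = non_zero Y a"
  by (auto simp: non_one_def non_zero_def)

lemma de_morgan_fun_neg: "a \<in> mv_space Y \<Longrightarrow> de_morgan Y Z f (fun_neg Y a) = fun_neg Z (f a)"
  by (simp add: de_morgan_def)

lemma de_morgan_de_morgan:
  "f \<in> mv_space Y \<rightarrow> mv_space Z \<Longrightarrow> a \<in> mv_space Y \<Longrightarrow>
    de_morgan Y Z (de_morgan Y Z f) a = f a"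
  by (simp add: de_morgan_def Pi_iff)

lemma fun_diff_fun_neg: "fun_diff Y (fun_neg Y b) (fun_neg Y a) = fun_diff Y a b"
  by (auto simp: fun_diff_def neg_minus_neg)

lemma non_expansive_de_morgan:
  assumes "non_expansive Y Z f"
  shows "non_expansive Y Z (de_morgan Y Z f)"
  unfolding non_expansive_def
proof (intro conjI ballI)
  fix a b :: "'a \<Rightarrow> 'c"
  assume ab: "a \<in> mv_space Y" "b \<in> mv_space Y"
  have "mv_norm Z (fun_diff Z (f (fun_neg Y a)) (f (fun_neg Y b)))
      \<le> mv_norm Y (fun_diff Y (fun_neg Y a) (fun_neg Y b))"
    using assms unfolding non_expansive_def by simp
  then show "mv_norm Z (fun_diff Z (de_morgan Y Z f b) (de_morgan Y Z f a)) \<le> mv_norm Y (fun_diff Y b a)"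
    by (simp add: de_morgan_def fun_diff_fun_neg)
qed (simp add: de_morgan_def Pi_iff)

lemma fun_add_fun_neg: "fun_add Y (fun_neg Y a) s = fun_neg Y (fun_diff Y a s)"
  by (auto simp: fun_add_def fun_neg_def fun_diff_def neg_minus)

text \<open>Lowering \<open>a\<close> by a step is raising \<open>\<sim> a\<close> by it, truncation
  included, and \<open>neg_minus_neg\<close> turns the loss of \<open>f\<close> into the growth of
  its conjugate. As this holds for each step separately, the thresholds agree too.\<close>

lemma dual_at_eq_primal_at:
  assumes "a \<in> mv_space Y"
  shows "dual_at Y Z f a = primal_at Y Z (de_morgan Y Z f) (fun_neg Y a)"
  using assms
  by (intro ext) (auto simp: dual_at_def primal_at_def fun_add_fun_neg de_morgan_fun_neg
      non_zero_def neg_minus_neg)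

lemma dual_eq_primal:
  assumes "a \<in> mv_space Y"
  shows "dual Y Z f a = primal Y Z (de_morgan Y Z f) (fun_neg Y a)"
proof -
  have "{a y | y. y \<in> non_zero Y a} = {\<sim> (fun_neg Y a y) | y. y \<in> non_zero Y a}"
    unfolding setcompr_eq_image by (intro image_cong) (auto simp: non_zero_def)
  then have gap: "dual_gap Y a = primal_gap Y (fun_neg Y a)"
    by (simp add: dual_gap_def primal_gap_def)
  show ?thesis
    using assms
    by (simp add: dual_def primal_def dual_iota_def primal_iota_def dual_iota_at_def
        primal_iota_at_def dual_at_eq_primal_at gap de_morgan_fun_neg)
qed

section \<open>Constants and reindexing\<close>

lemma non_expansive_const:
  "finite Y \<Longrightarrow> finite Z \<Longrightarrow> k \<in> mv_space Z \<Longrightarrow> non_expansive Y Z (const_map k)"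
  by (rule non_expansiveI) (auto simp: const_map_def)

lemma primal_const:
  assumes "finite Y" "finite Z" "k \<in> mv_space Z" "a \<in> mv_space Y" "Y' \<subseteq> non_one Y a"
  shows "primal Y Z (const_map k) a Y' = {}"
  using primal_iff_at[OF non_expansive_const assms(1,2,4,5)] assms(1-3)
  by (auto simp: primal_at_def const_map_def)

lemma dual_const:
  assumes "finite Y" "finite Z" "k \<in> mv_space Z" "a \<in> mv_space Y" "Y' \<subseteq> non_zero Y a"
  shows "dual Y Z (const_map k) a Y' = {}"
proof -
  have "de_morgan Y Z (const_map k) = const_map (fun_neg Z k)"
    by (simp add: fun_eq_iff de_morgan_def const_map_def)
  then show ?thesis using assms by (simp add: dual_eq_primal primal_const)
qed

lemma non_expansive_reindex:
  "finite Y \<Longrightarrow> finite Z \<Longrightarrow> u \<in> Z \<rightarrow> Y \<Longrightarrow> non_expansive Y Z (reindex Z u)"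
  by (rule non_expansiveI) (auto simp: reindex_def)

lemma primal_reindex:
  assumes fin: "finite Y" "finite Z" and u: "u \<in> Z \<rightarrow> Y"
    and a: "a \<in> mv_space Y" and Y': "Y' \<subseteq> non_one Y a"
  shows "primal Y Z (reindex Z u) a Y' = {z \<in> Z. u z \<in> Y'}"
proof (intro equalityI subsetI)
  note ne = non_expansive_reindex[OF fin u]
  fix z assume "z \<in> primal Y Z (reindex Z u) a Y'"
  then obtain \<theta> where "z \<in> Z" "0 < \<theta>"
    "\<theta> \<le> reindex Z u (fun_add Y a (step_fun Y \<theta> Y')) z \<ominus> reindex Z u a z"
    using primal_iff_at[OF ne fin a Y'] by (auto simp: primal_at_def non_one_def)
  moreover have "u z \<in> Y" using u \<open>z \<in> Z\<close> by blast
  ultimately show "z \<in> {z \<in> Z. u z \<in> Y'}"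
    by (auto simp: reindex_def fun_add_step split: if_splits)
next
  note ne = non_expansive_reindex[OF fin u]
  fix z assume "z \<in> {z \<in> Z. u z \<in> Y'}"
  then have z: "z \<in> Z" "u z \<in> Y'" "u z \<in> Y" "a (u z) \<noteq> mv_one"
    using Y' by (auto simp: non_one_def)
  show "z \<in> primal Y Z (reindex Z u) a Y'"
    \<comment> \<open>The step is the whole distance of \<open>a (u z)\<close> to
      \<open>mv_one\<close>, positive because \<open>u z\<close> lies in
      \<open>non_one Y a\<close>.\<close>
    by (rule primal_memI[OF ne fin a Y', where \<theta> = "\<sim> (a (u z))"])
      (use z in \<open>auto simp: non_one_def reindex_def fun_add_step zero_less_iff_neq_zero\<close>)
qed

lemma dual_reindex:
  assumes fin: "finite Y" "finite Z" and u: "u \<in> Z \<rightarrow> Y"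
    and a: "a \<in> mv_space Y" and Y': "Y' \<subseteq> non_zero Y a"
  shows "dual Y Z (reindex Z u) a Y' = {z \<in> Z. u z \<in> Y'}"
proof -
  have "de_morgan Y Z (reindex Z u) b = reindex Z u b" if "b \<in> mv_space Y" for b
    using u by (auto simp: de_morgan_def reindex_def fun_neg_def fun_eq_iff Pi_iff)
  then have "primal Y Z (de_morgan Y Z (reindex Z u)) (fun_neg Y a) =
      primal Y Z (reindex Z u) (fun_neg Y a)"
    by (intro primal_cong) auto
  then show ?thesis
    using assms by (simp add: dual_eq_primal primal_reindex)
qed

section \<open>Minimum and maximum\<close>

lemma neg_INF: "\<sim> (INF x\<in>A. g x) = (SUP x\<in>A. \<sim> (g x))" for g :: "'a \<Rightarrow> 'm::complete_mv_chain"
proof (rule antisym)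
  have "\<sim> (SUP x\<in>A. \<sim> (g x)) \<le> (INF x\<in>A. g x)"
    by (rule INF_greatest) (metis SUP_upper neg_le_neg_iff neg_neg)
  then show "\<sim> (INF x\<in>A. g x) \<le> (SUP x\<in>A. \<sim> (g x))" by (metis neg_le_neg_iff neg_neg)
qed (simp add: SUP_least INF_lower)

lemma min_rel_eq_INF:
  assumes "finite Y" "R \<subseteq> Y \<times> Z" "z \<in> Z"
  shows "min_rel Z R a z = (INF y\<in>{y \<in> Y. (y, z) \<in> R}. a y)"
proof -
  have "{y. (y, z) \<in> R} = {y \<in> Y. (y, z) \<in> R}" using assms by auto
  then show ?thesis using assms
    by (simp add: min_rel_def setcompr_eq_image mv_min_eq_Inf)
qed

lemma max_rel_eq_SUP:
  assumes "finite Y" "R \<subseteq> Y \<times> Z" "z \<in> Z"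
  shows "max_rel Z R a z = (SUP y\<in>{y \<in> Y. (y, z) \<in> R}. a y)"
proof -
  have "{y. (y, z) \<in> R} = {y \<in> Y. (y, z) \<in> R}" using assms by auto
  then show ?thesis using assms
    by (simp add: max_rel_def setcompr_eq_image mv_max_eq_Sup_finite)
qed

lemma min_rel_mem [simp]: "min_rel Z R a \<in> mv_space Z"
  by (simp add: min_rel_def)

lemma max_rel_mem [simp]: "max_rel Z R a \<in> mv_space Z"
  by (simp add: max_rel_def)

lemma de_morgan_min:
  assumes "finite Y" "R \<subseteq> Y \<times> Z" "a \<in> mv_space Y"
  shows "de_morgan Y Z (min_rel Z R) a = max_rel Z R a"
proof (rule PiE_ext[where k = Z and s = "\<lambda>_. UNIV"])
  fix z assume "z \<in> Z"
  then show "de_morgan Y Z (min_rel Z R) a z = max_rel Z R a z"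
    using assms by (simp add: de_morgan_def min_rel_eq_INF max_rel_eq_SUP neg_INF)
qed (simp_all add: de_morgan_def)

lemma de_morgan_max:
  assumes "finite Y" "R \<subseteq> Y \<times> Z" "a \<in> mv_space Y"
  shows "de_morgan Y Z (max_rel Z R) a = min_rel Z R a"
  using assms de_morgan_de_morgan[of "min_rel Z R" Y Z a]
  by (simp add: de_morgan_def[of _ _ "max_rel Z R"] de_morgan_def[of _ _ "de_morgan Y Z _"]
      de_morgan_min)

lemma INF_attained:
  fixes a :: "'y \<Rightarrow> 'm::complete_mv_chain"
  assumes "finite S" "S \<noteq> {}"
  obtains y where "y \<in> S" "a y = (INF y\<in>S. a y)"
proof -
  have "Min (a ` S) \<in> a ` S" using assms by (intro Min_in) auto
  then obtain y where "y \<in> S" "a y = Min (a ` S)" by force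
  then show thesis using assms that[of y] by (simp add: Min_Inf)
qed

lemma non_expansive_min:
  assumes fin: "finite Y" "finite Z" and R: "R \<subseteq> Y \<times> Z"
  shows "non_expansive Y Z (min_rel Z R)"
proof (rule non_expansiveI[OF fin])
  fix a b :: "'a \<Rightarrow> 'c" and t z
  assume le: "\<And>y. y \<in> Y \<Longrightarrow> b y \<le> a y + t" and z: "z \<in> Z"
  let ?S = "{y \<in> Y. (y, z) \<in> R}"
  show "min_rel Z R b z \<le> min_rel Z R a z + t"
  proof (cases "?S = {}")
    case True
    \<comment> \<open>An empty minimum is \<open>mv_one\<close> for both arguments, and adding
      \<open>t\<close> leaves it there.\<close>
    then show ?thesis by (simp add: min_rel_eq_INF[OF fin(1) R z] top_eq_one del: Collect_empty_eq)
  next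
    case False
    \<comment> \<open>Evaluating \<open>b\<close> at a minimiser of \<open>a\<close> bounds the
      minimum of \<open>b\<close>.\<close>
    then obtain y where "y \<in> ?S" "a y = (INF y\<in>?S. a y)"
      using INF_attained[of ?S a] fin(1) by auto
    then show ?thesis
      using le[of y] INF_lower[of y ?S b] by (simp add: min_rel_eq_INF[OF fin(1) R z])
  qed
qed simp

lemma non_expansive_max:
  assumes fin: "finite Y" "finite Z" and R: "R \<subseteq> Y \<times> Z"
  shows "non_expansive Y Z (max_rel Z R)"
  using non_expansive_de_morgan[OF non_expansive_min[OF assms]]
    non_expansive_cong[of Y "de_morgan Y Z (min_rel Z R)" "max_rel Z R"]
    de_morgan_min[OF fin(1) R] by blast

lemma arg_min_set_eq: "arg_min_set a S = {y \<in> S. a y = (INF y\<in>S. a y)}"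
  for a :: "'y \<Rightarrow> 'm::complete_mv_chain"
  by (auto simp: arg_min_set_def is_arg_min_linorder intro!: antisym INF_greatest INF_lower)

lemma arg_max_set_eq: "arg_max_set a S = {y \<in> S. a y = (SUP y\<in>S. a y)}"
  for a :: "'y \<Rightarrow> 'm::complete_mv_chain"
  by (auto simp: arg_max_set_def is_arg_max_linorder intro!: antisym SUP_least SUP_upper)

lemma arg_max_set_fun_neg: "S \<subseteq> Y \<Longrightarrow> arg_max_set (fun_neg Y a) S = arg_min_set a S"
  by (auto simp: arg_max_set_def arg_min_set_def is_arg_max_linorder is_arg_min_linorder subset_iff)

lemma arg_min_set_fun_neg: "S \<subseteq> Y \<Longrightarrow> arg_min_set (fun_neg Y a) S = arg_max_set a S"
  by (auto simp: arg_max_set_def arg_min_set_def is_arg_max_linorder is_arg_min_linorder subset_iff)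

lemma less_add_pos: "0 < t \<Longrightarrow> t \<le> \<sim> x \<Longrightarrow> x < x + t" for x t :: "'m::complete_mv_chain"
  using mv_add_cancel[of t x] by (metis add.commute le_add_left order_less_le)

text \<open>A minimiser left unraised keeps the minimum at its old value, while the other points lie
  strictly above it and do not matter for small steps. For an empty fibre the value is
  \<open>mv_one\<close>, so \<open>z\<close> is excluded by \<open>non_one\<close>.\<close>

lemma primal_min:
  assumes fin: "finite Y" "finite Z" and R: "R \<subseteq> Y \<times> Z"
    and a: "a \<in> mv_space Y" and Y': "Y' \<subseteq> non_one Y a"
  shows "primal Y Z (min_rel Z R) a Y' =
    {z \<in> non_one Z (min_rel Z R a). arg_min_set a {y \<in> Y. (y, z) \<in> R} \<subseteq> Y'}"
proof (intro equalityI subsetI)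
  note ne = non_expansive_min[OF fin R]
  note INF = min_rel_eq_INF[OF fin(1) R]
  fix z assume zP: "z \<in> primal Y Z (min_rel Z R) a Y'"
  then have z: "z \<in> non_one Z (min_rel Z R a)" by (simp add: primal_def primal_at_def)
  then have "0 < \<sim> (min_rel Z R a z)" by (simp add: non_one_def zero_less_iff_neq_zero)
  let ?S = "{y \<in> Y. (y, z) \<in> R}" and ?m = "min_rel Z R a z"
  from \<open>0 < \<sim> ?m\<close> obtain \<theta> where \<theta>: "0 < \<theta>" "\<theta> \<le> \<sim> ?m"
      "?m + \<theta> \<le> min_rel Z R (fun_add Y a (step_fun Y \<theta> Y')) z"
    by (rule primal_memE[OF ne fin a Y', OF zP])
  show "z \<in> {z \<in> non_one Z (min_rel Z R a). arg_min_set a {y \<in> Y. (y, z) \<in> R} \<subseteq> Y'}"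
  proof (safe intro!: z)
    have zZ: "z \<in> Z" using z by (simp add: non_one_def)
    fix y assume "y \<in> arg_min_set a ?S"
    then have y: "y \<in> ?S" "a y = ?m" by (auto simp: arg_min_set_eq INF zZ)
    have "?m + \<theta> \<le> fun_add Y a (step_fun Y \<theta> Y') y"
      using \<theta>(3) y(1) unfolding INF[OF zZ] by (auto simp: le_INF_iff)
    then show "y \<in> Y'"
      using less_add_pos[OF \<theta>(1,2)] y by (auto simp: fun_add_step not_le[symmetric] split: if_splits)
  qed
next
  note ne = non_expansive_min[OF fin R]
  note INF = min_rel_eq_INF[OF fin(1) R]
  fix z
  assume "z \<in> {z \<in> non_one Z (min_rel Z R a). arg_min_set a {y \<in> Y. (y, z) \<in> R} \<subseteq> Y'}"
  then have z: "z \<in> non_one Z (min_rel Z R a)" "z \<in> Z"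
    and sub: "arg_min_set a {y \<in> Y. (y, z) \<in> R} \<subseteq> Y'" by (auto simp: non_one_def)
  let ?S = "{y \<in> Y. (y, z) \<in> R}" and ?m = "min_rel Z R a z"
  \<comment> \<open>A step below the first element avoids truncation; one below the others keeps the
    raised minimum below every point that is not a minimiser.\<close>
  let ?\<Theta> = "insert (\<sim> ?m) ((\<lambda>y. a y \<ominus> ?m) ` {y \<in> ?S. ?m < a y})"
  define \<theta> where "\<theta> = Inf ?\<Theta>"
  have "0 < \<theta>"
    unfolding \<theta>_def using fin z
    by (intro inf_pos) (auto simp: minus_eq_zero_iff zero_less_iff_neq_zero non_one_def)
  moreover have "\<theta> \<le> \<sim> ?m" unfolding \<theta>_def by (rule Inf_lower) simp
  moreover have "?m + \<theta> \<le> fun_add Y a (step_fun Y \<theta> Y') y" if y: "y \<in> ?S" for y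
  proof (cases "a y = ?m")
    case True
    then have "y \<in> Y'" using sub y by (auto simp: arg_min_set_eq INF z)
    then show ?thesis using True y by (simp add: fun_add_step)
  next
    case False
    moreover have "?m \<le> a y" using y by (simp add: INF z INF_lower)
    ultimately have less: "?m < a y" by simp
    then have "\<theta> \<le> a y \<ominus> ?m" unfolding \<theta>_def using y by (intro Inf_lower) auto
    then have "?m + \<theta> \<le> a y"
      using less add_mono[of ?m ?m \<theta> "a y \<ominus> ?m"] by (simp add: add_minus_self)
    also have "\<dots> \<le> fun_add Y a (step_fun Y \<theta> Y') y" using y by (simp add: fun_add_step)
    finally show ?thesis .
  qed
  then have "?m + \<theta> \<le> min_rel Z R (fun_add Y a (step_fun Y \<theta> Y')) z"
    unfolding INF[OF z(2), of "fun_add Y a _"] by (rule INF_greatest)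
  ultimately show "z \<in> primal Y Z (min_rel Z R) a Y'"
    by (rule primal_memI[OF ne fin a Y', OF z(1)])
qed

text \<open>One raised maximiser is enough to raise the maximum, whereas a point strictly below it
  cannot overtake it under a small step.\<close>

lemma primal_max:
  assumes fin: "finite Y" "finite Z" and R: "R \<subseteq> Y \<times> Z"
    and a: "a \<in> mv_space Y" and Y': "Y' \<subseteq> non_one Y a"
  shows "primal Y Z (max_rel Z R) a Y' =
    {z \<in> non_one Z (max_rel Z R a). arg_max_set a {y \<in> Y. (y, z) \<in> R} \<inter> Y' \<noteq> {}}"
proof (intro equalityI subsetI)
  note ne = non_expansive_max[OF fin R]
  note SUP = max_rel_eq_SUP[OF fin(1) R]
  fix z assume zP: "z \<in> primal Y Z (max_rel Z R) a Y'"
  then have z: "z \<in> non_one Z (max_rel Z R a)" and zZ: "z \<in> Z"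
    by (auto simp: primal_def primal_at_def non_one_def)
  let ?S = "{y \<in> Y. (y, z) \<in> R}" and ?m = "max_rel Z R a z"
  \<comment> \<open>The distances to the maximum: a step below them cannot lift a non-maximiser
    beyond \<open>?m\<close>.\<close>
  let ?\<Theta> = "insert (\<sim> ?m) ((\<lambda>y. ?m \<ominus> a y) ` {y \<in> ?S. a y < ?m})"
  have "0 < Inf ?\<Theta>"
    using fin z
    by (intro inf_pos) (auto simp: minus_eq_zero_iff zero_less_iff_neq_zero non_one_def)
  then obtain \<theta> where \<theta>: "0 < \<theta>" "\<theta> \<le> Inf ?\<Theta>" "\<theta> \<le> \<sim> ?m"
      "?m + \<theta> \<le> max_rel Z R (fun_add Y a (step_fun Y \<theta> Y')) z"
    by (rule primal_memE[OF ne fin a Y', OF zP])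
  have "arg_max_set a ?S \<inter> Y' \<noteq> {}"
  proof
    assume disj: "arg_max_set a ?S \<inter> Y' = {}"
    have "fun_add Y a (step_fun Y \<theta> Y') y \<le> ?m" if y: "y \<in> ?S" for y
    proof (cases "a y = ?m")
      case True
      then have "y \<notin> Y'" using disj y by (auto simp: arg_max_set_eq SUP zZ)
      then show ?thesis using True y by (simp add: fun_add_step)
    next
      case False
      moreover have "a y \<le> ?m" using y by (simp add: SUP zZ SUP_upper)
      ultimately have less: "a y < ?m" by simp
      then have "Inf ?\<Theta> \<le> ?m \<ominus> a y" using y by (intro Inf_lower) auto
      with \<theta>(2) have "\<theta> \<le> ?m \<ominus> a y" by (rule order_trans)
      then have "a y + \<theta> \<le> a y + (?m \<ominus> a y)" by (rule add_left_mono)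
      then show ?thesis using y less by (simp add: add_minus_self fun_add_step order_less_imp_le)
    qed
    then have "max_rel Z R (fun_add Y a (step_fun Y \<theta> Y')) z \<le> ?m"
      unfolding SUP[OF zZ, of "fun_add Y a _"] by (rule SUP_least)
    then show False using \<theta>(4) less_add_pos[OF \<theta>(1,3)] by simp
  qed
  with z show "z \<in> {z \<in> non_one Z (max_rel Z R a).
      arg_max_set a {y \<in> Y. (y, z) \<in> R} \<inter> Y' \<noteq> {}}" by simp
next
  note ne = non_expansive_max[OF fin R]
  note SUP = max_rel_eq_SUP[OF fin(1) R]
  fix z
  assume "z \<in> {z \<in> non_one Z (max_rel Z R a). arg_max_set a {y \<in> Y. (y, z) \<in> R} \<inter> Y' \<noteq> {}}"
  then obtain y where z: "z \<in> non_one Z (max_rel Z R a)" "z \<in> Z"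
    and "y \<in> arg_max_set a {y \<in> Y. (y, z) \<in> R}" and "y \<in> Y'"
    by (auto simp: non_one_def)
  then have y: "y \<in> {y \<in> Y. (y, z) \<in> R}" "y \<in> Y'" "a y = max_rel Z R a z"
    by (simp_all add: arg_max_set_eq SUP)
  \<comment> \<open>The full distance to \<open>mv_one\<close>, which takes the raised maximiser all
    the way up.\<close>
  let ?\<theta> = "\<sim> (max_rel Z R a z)"
  show "z \<in> primal Y Z (max_rel Z R) a Y'"
  proof (rule primal_memI[OF ne fin a Y', OF z(1), of ?\<theta>])
    have "max_rel Z R a z + ?\<theta> = fun_add Y a (step_fun Y ?\<theta> Y') y"
      using y by (simp add: fun_add_step)
    also have "\<dots> \<le> max_rel Z R (fun_add Y a (step_fun Y ?\<theta> Y')) z"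
      unfolding SUP[OF z(2), of "fun_add Y a _"] using y(1) by (rule SUP_upper)
    finally show "max_rel Z R a z + ?\<theta> \<le> max_rel Z R (fun_add Y a (step_fun Y ?\<theta> Y')) z" .
  qed (use z in \<open>auto simp: non_one_def zero_less_iff_neq_zero\<close>)
qed

lemma dual_min:
  assumes fin: "finite Y" "finite Z" and R: "R \<subseteq> Y \<times> Z"
    and a: "a \<in> mv_space Y" and Y': "Y' \<subseteq> non_zero Y a"
  shows "dual Y Z (min_rel Z R) a Y' =
    {z \<in> non_zero Z (min_rel Z R a). arg_min_set a {y \<in> Y. (y, z) \<in> R} \<inter> Y' \<noteq> {}}"
proof -
  have "max_rel Z R (fun_neg Y a) = fun_neg Z (min_rel Z R a)"
    using a by (simp add: de_morgan_min[OF fin(1) R, symmetric] de_morgan_def)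
  then show ?thesis
    using primal_max[OF fin R fun_neg_mem, of Y' a] Y'
      primal_cong[OF de_morgan_min[OF fin(1) R] fun_neg_mem[of Y a]]
    by (simp add: dual_eq_primal[OF a] arg_max_set_fun_neg)
qed

lemma dual_max:
  assumes fin: "finite Y" "finite Z" and R: "R \<subseteq> Y \<times> Z"
    and a: "a \<in> mv_space Y" and Y': "Y' \<subseteq> non_zero Y a"
  shows "dual Y Z (max_rel Z R) a Y' =
    {z \<in> non_zero Z (max_rel Z R a). arg_max_set a {y \<in> Y. (y, z) \<in> R} \<subseteq> Y'}"
proof -
  have "min_rel Z R (fun_neg Y a) = fun_neg Z (max_rel Z R a)"
    using a by (simp add: de_morgan_max[OF fin(1) R, symmetric] de_morgan_def)
  then show ?thesis
    using primal_min[OF fin R fun_neg_mem, of Y' a] Y'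
      primal_cong[OF de_morgan_max[OF fin(1) R] fun_neg_mem[of Y a]]
    by (simp add: dual_eq_primal[OF a] arg_min_set_fun_neg)
qed

section \<open>Averages\<close>

text \<open>The definition of a distribution gives only a single point against all others; the
  induction moves the points of \<open>T\<close> across one at a time by
  \<open>orthogonal_assoc\<close>.\<close>

lemma distributions_orthogonal:
  assumes p: "p \<in> distributions Y" and "finite Y"
    and "S \<subseteq> Y" "T \<subseteq> Y" "S \<inter> T = {}"
  shows "sum p S \<le> \<sim> (sum p T)"
proof -
  have "finite T" using assms finite_subset by blast
  then show ?thesis using assms(4,5)
  proof (induction T)
    case (insert y T)
    have fin: "finite S" "finite T" using assms(2,3) insert.hyps finite_subset by blast+
    have "sum p S + sum p T = sum p (S \<union> T)"
      using fin insert.prems by (subst sum.union_disjoint) auto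
    also have "\<dots> \<le> sum p (Y - {y})"
      using insert assms(2,3) by (intro sum_mono2) auto
    also have "\<dots> = \<sim> (p y)" using p insert.prems by (simp add: distributions_def)
    finally have "sum p S + sum p T \<le> \<sim> (p y)" .
    with insert have "sum p S \<le> \<sim> (sum p T + p y)" by (intro orthogonal_assoc) auto
    then show ?case using insert.hyps by (simp add: add.commute)
  qed simp
qed

lemma distributions_sum:
  assumes p: "p \<in> distributions Y" and "finite Y" "Y \<noteq> {}"
  shows "sum p Y = mv_one"
proof -
  obtain y where y: "y \<in> Y" using assms(3) by blast
  have "sum p Y = p y + sum p (Y - {y})" using assms(2) y by (rule sum.remove)
  also have "\<dots> = p y + \<sim> (p y)" using p y by (simp add: distributions_def)
  finally have "sum p Y = p y + \<sim> (p y)" .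
  then show ?thesis by (simp add: add_neg_self)
qed

context mv_product
begin

text \<open>\<open>y'\<close> is the orthogonal sum of \<open>y\<close> and
  \<open>y' \<ominus> y\<close>, so \<open>prd_add\<close> applies.\<close>

lemma prd_mono:
  assumes "y \<le> y'"
  shows "x \<odot> y \<le> x \<odot> y'"
proof -
  have "y \<le> \<sim> (y' \<ominus> y)" unfolding le_neg_swap[of y] by (rule minus_le_neg)
  then have "x \<odot> (y + (y' \<ominus> y)) = x \<odot> y + x \<odot> (y' \<ominus> y)" by (rule prd_add)
  then show ?thesis using assms by (simp add: add_minus_self)
qed

lemma prd_le_right: "x \<odot> y \<le> y"
  unfolding commute[of x] by (rule prd_le)

text \<open>\<open>prd_add\<close> distributes only over orthogonal sums, which sums of weights of a
  distribution are.\<close>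

lemma prd_sum_distrib:
  assumes p: "p \<in> distributions Y" and "finite Y" "S \<subseteq> Y"
  shows "(\<Sum>y\<in>S. p y \<odot> t) = sum p S \<odot> t"
proof -
  have "finite S" using assms finite_subset by blast
  then show ?thesis using assms(3)
  proof (induction S)
    case empty
    then show ?case using prd_eq_zero_iff[of 0 t] by simp
  next
    case (insert y S)
    then have "sum p {y} \<le> \<sim> (sum p S)" by (intro distributions_orthogonal[OF p assms(2)]) auto
    then have "t \<odot> (p y + sum p S) = t \<odot> p y + t \<odot> sum p S" by (intro prd_add) simp
    then have "p y \<odot> t + sum p S \<odot> t = (p y + sum p S) \<odot> t" by (simp only: commute[of _ t])
    then show ?case using insert by simp
  qed
qed

lemma prd_sum_const:
  "p \<in> distributions Y \<Longrightarrow> finite Y \<Longrightarrow> Y \<noteq> {} \<Longrightarrow> (\<Sum>y\<in>Y. p y \<odot> t) = t"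
  by (simp add: prd_sum_distrib distributions_sum)

lemma sum_prd_le_sum: "(\<Sum>y\<in>S. p y \<odot> a y) \<le> sum p S"
  by (intro sum_mono prd_le)

lemma prd_add_neg: "p \<odot> a + p \<odot> \<sim> a = p"
  using prd_add[of a "\<sim> a" p] by (simp add: add_neg_self)

text \<open>Each weight \<open>p y\<close> splits into \<open>p y \<odot> a y\<close> and
  \<open>p y \<odot> \<sim> (a y)\<close>. The weights add up without truncation, so their pieces
  may be regrouped freely.\<close>

lemma orthogonal_prd_neg:
  assumes p: "p \<in> distributions Y" and "finite Y" "S \<subseteq> Y"
  shows "(\<Sum>y\<in>S. p y \<odot> a y) \<le> \<sim> (\<Sum>y\<in>S. p y \<odot> \<sim> (a y))"
proof -
  have "finite S" using assms finite_subset by blast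
  then show ?thesis using assms(3)
  proof (induction S)
    case (insert y S)
    let ?A = "\<Sum>y\<in>S. p y \<odot> a y" and ?B = "\<Sum>y\<in>S. p y \<odot> \<sim> (a y)"
    let ?c = "p y \<odot> a y" and ?d = "p y \<odot> \<sim> (a y)"
    have AB: "?A \<le> \<sim> ?B" using insert by simp
    have cd: "?c \<le> \<sim> ?d"
    proof -
      have "?c \<le> a y" by (rule prd_le_right)
      also have "\<dots> \<le> \<sim> ?d" unfolding le_neg_swap[of "a y"] by (rule prd_le_right)
      finally show ?thesis .
    qed
    have "?A + ?B = sum p S" by (simp add: sum.distrib[symmetric] prd_add_neg)
    also have "\<dots> \<le> \<sim> (sum p {y})"
      using insert by (intro distributions_orthogonal[OF p assms(2)]) auto
    finally have ABcd: "?A + ?B \<le> \<sim> (?c + ?d)" by (simp add: prd_add_neg)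
    \<comment> \<open>\<open>?A\<close>, \<open>?B\<close>, \<open>?c\<close>, \<open>?d\<close> are
      jointly orthogonal; three uses of \<open>orthogonal_assoc\<close> regroup them into
      \<open>?c + ?A\<close> against \<open>?d + ?B\<close>.\<close>
    then have "?c + ?d \<le> \<sim> (?A + ?B)" by (simp only: le_neg_swap[of "?c + ?d"])
    also have "\<dots> \<le> \<sim> ?B" by simp
    finally have "?c \<le> \<sim> (?d + ?B)" by (rule orthogonal_assoc[OF cd])
    then have dB: "?d + ?B \<le> \<sim> ?c" by (simp only: le_neg_swap[of "?d + ?B"])
    have "?A \<le> \<sim> (?B + (?c + ?d))" by (rule orthogonal_assoc[OF AB ABcd])
    then have "?B + (?c + ?d) \<le> \<sim> ?A" by (simp only: le_neg_swap[of "?B + (?c + ?d)"])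
    then have "?d + ?B + ?c \<le> \<sim> ?A" by (simp only: ac_simps)
    then have "?d + ?B \<le> \<sim> (?c + ?A)" by (rule orthogonal_assoc[OF dB])
    then show ?case using insert.hyps by (simp only: sum.insert le_neg_swap[of "?c + ?A"] not_False_eq_True)
  qed simp
qed

text \<open>Two elements with sum \<open>mv_one\<close> are complementary only if they are also
  orthogonal; each property supplies one inequality. This makes averages self-dual.\<close>

lemma sum_prd_neg:
  assumes p: "p \<in> distributions Y" and "finite Y" "Y \<noteq> {}"
  shows "(\<Sum>y\<in>Y. p y \<odot> \<sim> (a y)) = \<sim> (\<Sum>y\<in>Y. p y \<odot> a y)"
proof (rule antisym)
  let ?A = "\<Sum>y\<in>Y. p y \<odot> a y" and ?B = "\<Sum>y\<in>Y. p y \<odot> \<sim> (a y)"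
  have "?A \<le> \<sim> ?B" by (rule orthogonal_prd_neg[OF p assms(2)]) simp
  then show "?B \<le> \<sim> ?A" by (simp only: le_neg_swap[of ?B])
  have "?A + ?B = mv_one"
    using distributions_sum[OF assms] by (simp add: sum.distrib[symmetric] prd_add_neg)
  then show "\<sim> ?A \<le> ?B" by (simp add: le_iff_neg_add)
qed

lemma average_mem [simp]: "average (\<odot>) Y D a \<in> mv_space D"
  by (simp add: average_def)

lemma non_expansive_average:
  fixes Y :: "'y set" and D :: "('y \<Rightarrow> 'm) set"
  assumes fin: "finite Y" "finite D" and "Y \<noteq> {}" and D: "D \<subseteq> distributions Y"
  shows "non_expansive Y D (average (\<odot>) Y D)"
proof (rule non_expansiveI[OF fin])
  fix a b :: "'y \<Rightarrow> 'm" and t p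
  assume le: "\<And>y. y \<in> Y \<Longrightarrow> b y \<le> a y + t" and p: "p \<in> D"
  have step: "p y \<odot> b y \<le> p y \<odot> a y + p y \<odot> t" if y: "y \<in> Y" for y
  proof -
    \<comment> \<open>\<open>a y + t\<close> may be truncated, so \<open>prd_add\<close> cannot
      split it; the exact increment \<open>b y \<ominus> a y\<close> is orthogonal to
      \<open>a y\<close> and is bounded by \<open>t\<close> afterwards.\<close>
    have orth: "a y \<le> \<sim> (b y \<ominus> a y)" unfolding le_neg_swap[of "a y"] by (rule minus_le_neg)
    have "p y \<odot> b y \<le> p y \<odot> (a y + (b y \<ominus> a y))"
      by (intro prd_mono) (simp add: add_minus_eq_max)
    also have "\<dots> = p y \<odot> a y + p y \<odot> (b y \<ominus> a y)" by (rule prd_add[OF orth])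
    also have "\<dots> \<le> p y \<odot> a y + p y \<odot> t"
      using le[OF y] by (intro add_left_mono prd_mono) (simp add: minus_le_iff)
    finally show ?thesis .
  qed
  have "(\<Sum>y\<in>Y. p y \<odot> b y) \<le> (\<Sum>y\<in>Y. p y \<odot> a y + p y \<odot> t)"
    by (rule sum_mono) (rule step)
  also have "\<dots> = (\<Sum>y\<in>Y. p y \<odot> a y) + t"
    using prd_sum_const[of p Y t] p D fin assms(3) by (auto simp: sum.distrib)
  finally show "average (\<odot>) Y D b p \<le> average (\<odot>) Y D a p + t"
    using p by (simp add: average_def)
qed simp

text \<open>The bound on \<theta> keeps \<open>a y + \<theta>\<close> untruncated on
  \<open>Y'\<close>, so each raised term splits.\<close>

lemma average_step:
  assumes "finite Y" "p \<in> D" "Y' \<subseteq> Y" and le: "\<And>y. y \<in> Y' \<Longrightarrow> \<theta> \<le> \<sim> (a y)"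
  shows "average (\<odot>) Y D (fun_add Y a (step_fun Y \<theta> Y')) p =
    average (\<odot>) Y D a p + (\<Sum>y\<in>Y'. p y \<odot> \<theta>)"
proof -
  have "p y \<odot> fun_add Y a (step_fun Y \<theta> Y') y = p y \<odot> a y + (if y \<in> Y' then p y \<odot> \<theta> else 0)"
    if "y \<in> Y" for y
    using that le[of y] prd_add[of \<theta> "a y" "p y"] by (simp add: fun_add_step add.commute)
  then have "(\<Sum>y\<in>Y. p y \<odot> fun_add Y a (step_fun Y \<theta> Y') y) =
      (\<Sum>y\<in>Y. p y \<odot> a y) + (\<Sum>y\<in>Y. if y \<in> Y' then p y \<odot> \<theta> else 0)"
    by (simp add: sum.distrib)
  also have "(\<Sum>y\<in>Y. if y \<in> Y' then p y \<odot> \<theta> else 0) = (\<Sum>y\<in>Y'. p y \<odot> \<theta>)"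
    using assms by (simp add: sum.inter_restrict[symmetric] Int_absorb1)
  finally show ?thesis using assms(2) by (simp add: average_def)
qed

text \<open>The constant \<theta> averages to itself and splits into the parts over
  \<open>Y'\<close> and over \<open>Y - Y'\<close>. A small step raises the average by the first
  part only, so it succeeds iff the second part vanishes.\<close>

lemma primal_average:
  assumes fin: "finite Y" "finite D" and Y: "Y \<noteq> {}" and D: "D \<subseteq> distributions Y"
    and a: "a \<in> mv_space Y" and Y': "Y' \<subseteq> non_one Y a"
  shows "primal Y D (average (\<odot>) Y D) a Y' =
    {p \<in> non_one D (average (\<odot>) Y D a). supp Y p \<subseteq> Y'}"
proof (intro Set.set_eqI)
  fix p
  note ne = non_expansive_average[OF fin Y D]
  let ?F = "average (\<odot>) Y D a p"
  let ?X = "\<lambda>\<theta>. \<Sum>y\<in>Y'. p y \<odot> \<theta>" and ?X' = "\<lambda>\<theta>. \<Sum>y\<in>Y - Y'. p y \<odot> \<theta>"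
  show "p \<in> primal Y D (average (\<odot>) Y D) a Y' \<longleftrightarrow>
    p \<in> {p \<in> non_one D (average (\<odot>) Y D a). supp Y p \<subseteq> Y'}"
  proof (cases "p \<in> non_one D (average (\<odot>) Y D a)")
    case True
    then have pD: "p \<in> D" and F: "?F \<noteq> mv_one" by (auto simp: non_one_def)
    then have p: "p \<in> distributions Y" using D by blast
    have Y'Y: "Y' \<subseteq> Y" using Y' by (auto simp: non_one_def)
    have finY': "finite Y'" using Y'Y fin(1) finite_subset by blast
    have split: "?X \<theta> + ?X' \<theta> = \<theta>" for \<theta>
      using prd_sum_const[OF p fin(1) Y, of \<theta>] sum.subset_diff[OF Y'Y fin(1), of "\<lambda>y. p y \<odot> \<theta>"]
      by (simp add: add.commute)
    \<comment> \<open>Steps up to \<gamma> truncate neither \<open>a\<close> on \<open>Y'\<close>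
      nor the average at \<open>p\<close>.\<close>
    define \<gamma> where "\<gamma> = Inf (insert (\<sim> ?F) ((\<lambda>y. \<sim> (a y)) ` Y'))"
    have "0 < \<gamma>"
      unfolding \<gamma>_def using F Y' finY'
      by (intro inf_pos) (auto simp: zero_less_iff_neq_zero non_one_def)
    have \<gamma>F: "\<gamma> \<le> \<sim> ?F" unfolding \<gamma>_def by (rule Inf_lower) simp
    have step: "average (\<odot>) Y D (fun_add Y a (step_fun Y \<theta> Y')) p = ?F + ?X \<theta>"
      if "\<theta> \<le> \<gamma>" for \<theta>
    proof (rule average_step[OF fin(1) pD Y'Y])
      fix y assume "y \<in> Y'"
      then have "\<gamma> \<le> \<sim> (a y)" unfolding \<gamma>_def by (intro Inf_lower) simp
      with that show "\<theta> \<le> \<sim> (a y)" by (rule order_trans)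
    qed
    show ?thesis
    proof
      assume "p \<in> primal Y D (average (\<odot>) Y D) a Y'"
      then obtain \<theta> where \<theta>: "0 < \<theta>" "\<theta> \<le> \<gamma>" "\<theta> \<le> \<sim> ?F"
          "?F + \<theta> \<le> average (\<odot>) Y D (fun_add Y a (step_fun Y \<theta> Y')) p"
        by (rule primal_memE[OF ne fin a Y', OF _ \<open>0 < \<gamma>\<close>])
      have X: "?X \<theta> \<le> \<theta>" using le_add_left[of "?X \<theta>" "?X' \<theta>"] unfolding split .
      have "\<theta> \<le> (?F + \<theta>) \<ominus> ?F" using \<theta>(3) by (intro le_minusI) simp_all
      also have "\<dots> \<le> (?F + ?X \<theta>) \<ominus> ?F" using \<theta>(4) by (simp add: step[OF \<theta>(2)] minus_mono)
      also have "\<dots> \<le> ?X \<theta>" by (simp add: minus_le_iff)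
      finally have "?X \<theta> = \<theta>" using X by (rule antisym[rotated])
      then have eq: "?X' \<theta> + ?X \<theta> = ?X \<theta>" using split[of \<theta>] by (simp add: add.commute)
      \<comment> \<open>The two parts must be orthogonal before \<open>?X \<theta>\<close> can be
        cancelled from \<open>eq\<close>.\<close>
      have "?X' \<theta> \<le> sum p (Y - Y')" by (rule sum_prd_le_sum)
      also have "\<dots> \<le> \<sim> (sum p Y')"
        using Y'Y by (intro distributions_orthogonal[OF p fin(1)]) auto
      also have "\<dots> \<le> \<sim> (?X \<theta>)" using sum_prd_le_sum[of p "\<lambda>_. \<theta>" Y'] by simp
      finally have "?X' \<theta> = 0" using eq by (rule mv_add_cancel)
      \<comment> \<open>All elements are nonnegative, so a vanishing sum has vanishing terms; the
        product has no zero divisors and \<open>\<theta>\<close> is positive.\<close>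
      then have "p y \<odot> \<theta> = 0" if "y \<in> Y - Y'" for y
        using that sum_nonneg_eq_0_iff[of "Y - Y'" "\<lambda>y. p y \<odot> \<theta>"] fin(1) by simp
      then have "supp Y p \<subseteq> Y'" using \<theta>(1) by (auto simp: supp_def prd_eq_zero_iff)
      with True show "p \<in> {p \<in> non_one D (average (\<odot>) Y D a). supp Y p \<subseteq> Y'}" by simp
    next
      assume "p \<in> {p \<in> non_one D (average (\<odot>) Y D a). supp Y p \<subseteq> Y'}"
      then have "p y \<odot> \<gamma> = 0" if "y \<in> Y - Y'" for y
        using that by (auto simp: supp_def prd_eq_zero_iff)
      then have "?X' \<gamma> = 0" by (intro sum.neutral) blast
      then have "?X \<gamma> = \<gamma>" using split[of \<gamma>] by simp
      then show "p \<in> primal Y D (average (\<odot>) Y D) a Y'"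
        using step[of \<gamma>] by (intro primal_memI[OF ne fin a Y', OF True \<open>0 < \<gamma>\<close> \<gamma>F]) simp
    qed
  qed (auto simp: primal_def primal_at_def)
qed

lemma dual_average:
  assumes fin: "finite Y" "finite D" and Y: "Y \<noteq> {}" and D: "D \<subseteq> distributions Y"
    and a: "a \<in> mv_space Y" and Y': "Y' \<subseteq> non_zero Y a"
  shows "dual Y D (average (\<odot>) Y D) a Y' =
    {p \<in> non_zero D (average (\<odot>) Y D a). supp Y p \<subseteq> Y'}"
proof -
  have neg: "average (\<odot>) Y D (fun_neg Y b) = fun_neg D (average (\<odot>) Y D b)" for b
  proof
    fix p
    show "average (\<odot>) Y D (fun_neg Y b) p = fun_neg D (average (\<odot>) Y D b) p"
      using sum_prd_neg[of p Y b] D fin(1) Y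
      by (cases "p \<in> D") (auto simp: average_def fun_neg_def)
  qed
  have "de_morgan Y D (average (\<odot>) Y D) = average (\<odot>) Y D"
    by (rule ext) (simp only: de_morgan_def neg fun_neg_neg[OF average_mem])
  then show ?thesis
    using primal_average[OF fin Y D fun_neg_mem, of Y' a] Y'
    by (simp add: dual_eq_primal[OF a] neg)
qed

end

section \<open>Composition\<close>

lemma non_expansive_comp:
  assumes "non_expansive Y W g" "non_expansive W Z h"
  shows "non_expansive Y Z (h \<circ> g)"
  unfolding non_expansive_def
proof (intro conjI ballI)
  show "h \<circ> g \<in> mv_space Y \<rightarrow> mv_space Z"
    using assms unfolding non_expansive_def Pi_iff comp_apply by blast
  fix a b :: "'a \<Rightarrow> 'c" assume ab: "a \<in> mv_space Y" "b \<in> mv_space Y"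
  have "mv_norm Z (fun_diff Z (h (g b)) (h (g a))) \<le> mv_norm W (fun_diff W (g b) (g a))"
    using assms(2) non_expansive_mem[OF assms(1)] ab unfolding non_expansive_def by blast
  also have "\<dots> \<le> mv_norm Y (fun_diff Y b a)"
    using assms(1) ab unfolding non_expansive_def by blast
  finally show "mv_norm Z (fun_diff Z ((h \<circ> g) b) ((h \<circ> g) a)) \<le> mv_norm Y (fun_diff Y b a)"
    by simp
qed

text \<open>The obstacle is that \<open>g\<close> may still grow outside its approximation, only by
  less than the step; this remainder has to be subtracted before \<open>h\<close> is
  applied.\<close>

lemma primal_comp_subset:
  assumes g: "non_expansive Y W g" and h: "non_expansive W Z h"
    and fin: "finite Y" "finite W" "finite Z"
    and a: "a \<in> mv_space Y" and Y': "Y' \<subseteq> non_one Y a"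
  shows "primal Y Z (h \<circ> g) a Y' \<subseteq> primal W Z h (g a) (primal Y W g a Y')"
proof
  let ?V = "primal Y W g a Y'"
  have ga: "g a \<in> mv_space W" using g a by (rule non_expansive_mem)
  have V: "?V \<subseteq> non_one W (g a)" by (auto simp: primal_def primal_at_def)
  fix z assume "z \<in> primal Y Z (h \<circ> g) a Y'"
  then obtain \<theta> where \<theta>: "0 < \<theta>" and "z \<in> primal_at Y Z (h \<circ> g) a \<theta> Y'"
    using primal_iff_at[OF non_expansive_comp[OF g h] fin(1,3) a Y'] by blast
  define b where "b = g (fun_add Y a (step_fun Y \<theta> Y'))"
  have z: "z \<in> non_one Z (h (g a))" "z \<in> Z" and \<theta>_le: "\<theta> \<le> h b z \<ominus> h (g a) z"
    using \<open>z \<in> primal_at Y Z (h \<circ> g) a \<theta> Y'\<close>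
    by (auto simp: primal_at_def non_one_def b_def)
  have b: "b \<in> mv_space W" unfolding b_def by (rule non_expansive_mem[OF g]) simp
  \<comment> \<open>Outside \<open>V\<close> the growth of \<open>g\<close> is at most \<open>\<eta> < \<theta>\<close>; the step \<open>\<theta> \<ominus> \<eta>\<close> on \<open>V\<close> alone then
      already makes \<open>h\<close> grow by \<open>\<theta> \<ominus> \<eta>\<close>.\<close>
  define \<eta> where "\<eta> = Max (insert 0 ((\<lambda>w. b w \<ominus> g a w) ` (W - ?V)))"
  have small: "b w \<ominus> g a w < \<theta>" if w: "w \<in> W - ?V" for w
  proof (cases "w \<in> non_one W (g a)")
    case True
    then have "\<not> \<theta> \<le> b w \<ominus> g a w"
      using w \<theta> primal_iff_at[OF g fin(1,2) a Y', of w] unfolding primal_at_def b_def by blast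
    then show ?thesis by simp
  next
    case False
    then have "g a w = mv_one" using w by (simp add: non_one_def)
    then have "b w \<ominus> g a w = 0" by (simp add: minus_eq_zero_iff)
    with \<theta> show ?thesis by simp
  qed
  have "\<eta> < \<theta>" unfolding \<eta>_def using \<theta> small fin(2) by (subst Max_less_iff) auto
  have \<eta>_ge: "b w \<ominus> g a w \<le> \<eta>" if "w \<in> W - ?V" for w
    unfolding \<eta>_def using that fin(2) by (intro Max_ge) auto
  define \<epsilon> where "\<epsilon> = \<theta> \<ominus> \<eta>"
  have \<epsilon>: "0 < \<epsilon>" "\<eta> + \<epsilon> = \<theta>"
    using \<open>\<eta> < \<theta>\<close> minus_pos_iff[of \<theta> \<eta>] add_minus_self[of \<eta> \<theta>]
    by (auto simp: \<epsilon>_def order_less_imp_le)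
  let ?c = "fun_add W (g a) (step_fun W \<epsilon> ?V)"
  \<comment> \<open>On \<open>?V\<close> non-expansiveness of \<open>g\<close> limits the growth to
    \<open>\<theta> = \<epsilon> + \<eta>\<close>, elsewhere \<eta> bounds it; so \<open>b\<close>
    exceeds \<open>?c\<close> by at most \<eta>.\<close>
  have "b w \<le> ?c w + \<eta>" if w: "w \<in> W" for w
  proof (cases "w \<in> ?V")
    case True
    have "b w \<le> g a w + \<theta>"
      unfolding b_def
      by (rule non_expansiveD[OF g fin(1,2) a _ _ w]) (auto simp: fun_add_step)
    also have "\<dots> = ?c w + \<eta>" using True w by (simp add: fun_add_step \<epsilon>(2)[symmetric] ac_simps)
    finally show ?thesis .
  next
    case False
    then have "b w \<ominus> g a w \<le> \<eta>" using \<eta>_ge w by simp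
    then show ?thesis using False w by (simp add: fun_add_step minus_le_iff)
  qed
  then have "h b z \<le> h ?c z + \<eta>"
    by (intro non_expansiveD[OF h fin(2,3) _ b _ z(2)]) auto
  also have "\<dots> \<le> (h (g a) z + (h ?c z \<ominus> h (g a) z)) + \<eta>"
    by (intro add_right_mono) (simp add: add_minus_eq_max)
  finally have "h b z \<ominus> h (g a) z \<le> \<eta> + (h ?c z \<ominus> h (g a) z)"
    by (simp add: minus_le_iff ac_simps)
  with \<theta>_le have "\<theta> \<le> \<eta> + (h ?c z \<ominus> h (g a) z)" by (rule order_trans)
  then have "\<epsilon> \<le> h ?c z \<ominus> h (g a) z" unfolding \<epsilon>_def by (simp only: minus_le_iff)
  then have "z \<in> primal_at W Z h (g a) \<epsilon> ?V" using z by (simp add: primal_at_def)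
  then show "z \<in> primal W Z h (g a) ?V"
    using primal_iff_at[OF h fin(2,3) ga V] \<epsilon>(1) by blast
qed

text \<open>With one step valid for both maps, \<open>g\<close> grows by at least that step on all
  of \<open>?V\<close>, and monotonicity of \<open>h\<close> transfers the growth.\<close>

lemma primal_comp_supset:
  fixes g :: "('y \<Rightarrow> 'm::complete_mv_chain) \<Rightarrow> ('w \<Rightarrow> 'm)"
  assumes g: "non_expansive Y W g" and h: "non_expansive W Z h"
    and fin: "finite Y" "finite W" "finite Z"
    and a: "a \<in> mv_space Y" and Y': "Y' \<subseteq> non_one Y a"
  shows "primal W Z h (g a) (primal Y W g a Y') \<subseteq> primal Y Z (h \<circ> g) a Y'"
proof
  let ?V = "primal Y W g a Y'"
  have ga: "g a \<in> mv_space W" using g a by (rule non_expansive_mem)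
  have V: "?V \<subseteq> non_one W (g a)" by (auto simp: primal_def primal_at_def)
  fix z assume "z \<in> primal W Z h (g a) ?V"
  then obtain \<theta>' where \<theta>': "0 < \<theta>'" "z \<in> primal_at W Z h (g a) \<theta>' ?V"
    using primal_iff_at[OF h fin(2,3) ga V] by blast
  then have "h (g a) z \<noteq> mv_one" by (simp add: primal_at_def non_one_def)
  then have nt: "(0 :: 'm) \<noteq> mv_one" by (metis le_one le_zero_eq)
  \<comment> \<open>Below \<open>\<theta>'\<close> the step works for \<open>h\<close>; below
    \<open>primal_iota Y W g a\<close> it works for \<open>g\<close> at every point of
    \<open>?V\<close> simultaneously.\<close>
  define \<theta> where "\<theta> = min \<theta>' (primal_iota Y W g a)"
  have \<theta>: "0 < \<theta>"
    unfolding \<theta>_def min_less_iff_conj using \<theta>'(1) primal_iota_pos[OF fin(1,2) nt] by blast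
  have "z \<in> primal_at W Z h (g a) \<theta> ?V"
    using primal_at_antimono[OF h fin(2,3) ga, of \<theta> \<theta>'] \<theta>'(2) unfolding \<theta>_def by auto
  then have z: "z \<in> non_one Z (h (g a))" "z \<in> Z"
    and le: "\<theta> \<le> h (fun_add W (g a) (step_fun W \<theta> ?V)) z \<ominus> h (g a) z"
    by (auto simp: primal_at_def non_one_def)
  have V_at: "?V \<subseteq> primal_at Y W g a \<theta> Y'"
    unfolding primal_def by (rule primal_at_antimono[OF g fin(1,2) a]) (simp add: \<theta>_def)
  let ?b = "g (fun_add Y a (step_fun Y \<theta> Y'))"
  have "fun_add W (g a) (step_fun W \<theta> ?V) w \<le> ?b w" if w: "w \<in> W" for w
  proof (cases "w \<in> ?V")
    case True
    then have "\<theta> \<le> ?b w \<ominus> g a w" using V_at by (auto simp: primal_at_def)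
    then have "g a w + \<theta> \<le> ?b w" by (rule le_minusD(2)[OF \<theta>])
    then show ?thesis using True w by (simp add: fun_add_step)
  next
    case False
    have "g a w \<le> ?b w"
      by (rule non_expansive_mono[OF g fin(1,2) a _ _ w]) (auto simp: fun_add_step)
    then show ?thesis using False w by (simp add: fun_add_step)
  qed
  then have "h (fun_add W (g a) (step_fun W \<theta> ?V)) z \<le> h ?b z"
    by (intro non_expansive_mono[OF h fin(2,3) _ _ _ z(2)] non_expansive_mem[OF g] fun_add_mem)
  then have "\<theta> \<le> h ?b z \<ominus> h (g a) z" by (rule order_trans[OF le minus_mono])
  then have "z \<in> primal_at Y Z (h \<circ> g) a \<theta> Y'" using z by (simp add: primal_at_def)
  then show "z \<in> primal Y Z (h \<circ> g) a Y'"
    using primal_iff_at[OF non_expansive_comp[OF g h] fin(1,3) a Y'] \<theta> by blast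
qed

lemma primal_comp:
  assumes "non_expansive Y W g" "non_expansive W Z h" "finite Y" "finite W" "finite Z"
    and "a \<in> mv_space Y" "Y' \<subseteq> non_one Y a"
  shows "primal Y Z (h \<circ> g) a Y' = primal W Z h (g a) (primal Y W g a Y')"
  using primal_comp_subset[OF assms] primal_comp_supset[OF assms] by (rule equalityI)

lemma dual_comp:
  assumes g: "non_expansive Y W g" and h: "non_expansive W Z h"
    and fin: "finite Y" "finite W" "finite Z"
    and a: "a \<in> mv_space Y" and Y': "Y' \<subseteq> non_zero Y a"
  shows "dual Y Z (h \<circ> g) a Y' = dual W Z h (g a) (dual Y W g a Y')"
proof -
  have ga: "g a \<in> mv_space W" using g a by (rule non_expansive_mem)
  \<comment> \<open>The two inner negations cancel because \<open>g\<close> maps into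
    \<open>mv_space W\<close>.\<close>
  have "de_morgan Y Z (h \<circ> g) b = (de_morgan W Z h \<circ> de_morgan Y W g) b" if "b \<in> mv_space Y" for b
    using non_expansive_mem[OF g fun_neg_mem] by (simp add: de_morgan_def)
  then have "primal Y Z (de_morgan Y Z (h \<circ> g)) (fun_neg Y a) =
      primal Y Z (de_morgan W Z h \<circ> de_morgan Y W g) (fun_neg Y a)"
    by (intro primal_cong) auto
  then show ?thesis
    using primal_comp[OF non_expansive_de_morgan[OF g] non_expansive_de_morgan[OF h] fin
        fun_neg_mem, of Y' a] Y'
    by (simp add: dual_eq_primal[OF a] dual_eq_primal[OF ga] de_morgan_fun_neg[OF a])
qed

section \<open>Disjoint unions\<close>

lemma disjoint_union_map_apply:
  assumes "disjoint_family_on Zs I" "i \<in> I" "z \<in> Zs i"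
  shows "disjoint_union_map I Ys Zs fs a z = fs i (restrict a (Ys i)) z"
proof -
  have "(THE i. i \<in> I \<and> z \<in> Zs i) = i"
    using assms by (intro the_equality) (auto simp: disjoint_family_on_def)
  then show ?thesis using assms by (auto simp: disjoint_union_map_def)
qed

lemma disjoint_union_map_mem [simp]: "disjoint_union_map I Ys Zs fs a \<in> mv_space (\<Union>i\<in>I. Zs i)"
  by (simp add: disjoint_union_map_def)

lemma non_expansive_disjoint_union:
  fixes fs :: "'i \<Rightarrow> ('y \<Rightarrow> 'm::complete_mv_chain) \<Rightarrow> ('z \<Rightarrow> 'm)"
  assumes I: "finite I" and fs: "\<And>i. i \<in> I \<Longrightarrow> non_expansive (Ys i) (Zs i) (fs i)"
    and fin: "\<And>i. i \<in> I \<Longrightarrow> finite (Ys i)" "\<And>i. i \<in> I \<Longrightarrow> finite (Zs i)"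
    and disj: "disjoint_family_on Zs I"
  shows "non_expansive (\<Union>i\<in>I. Ys i) (\<Union>i\<in>I. Zs i) (disjoint_union_map I Ys Zs fs)"
proof (rule non_expansiveI)
  fix a b :: "'y \<Rightarrow> 'm" and t z
  assume le: "\<And>y. y \<in> (\<Union>i\<in>I. Ys i) \<Longrightarrow> b y \<le> a y + t" and "z \<in> (\<Union>i\<in>I. Zs i)"
  then obtain i where i: "i \<in> I" "z \<in> Zs i" by blast
  have "fs i (restrict b (Ys i)) z \<le> fs i (restrict a (Ys i)) z + t"
    by (rule non_expansiveD[OF fs fin _ _ _ i(2)]) (use i(1) le in auto)
  then show "disjoint_union_map I Ys Zs fs b z \<le> disjoint_union_map I Ys Zs fs a z + t"
    by (simp add: disjoint_union_map_apply[OF disj i])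
qed (use I fin in auto)

text \<open>A point of \<open>Zs i\<close> sees only the restriction to \<open>Ys i\<close>, and
  restriction commutes with adding a step; overlaps between the \<open>Ys i\<close> are
  harmless.\<close>

lemma primal_at_disjoint_union:
  assumes disj: "disjoint_family_on Zs I" and i: "i \<in> I" "z \<in> Zs i"
  shows "z \<in> primal_at (\<Union>i\<in>I. Ys i) (\<Union>i\<in>I. Zs i) (disjoint_union_map I Ys Zs fs) a \<theta> Y' \<longleftrightarrow>
    z \<in> primal_at (Ys i) (Zs i) (fs i) (restrict a (Ys i)) \<theta> (Y' \<inter> Ys i)"
proof -
  have "restrict (fun_add (\<Union>i\<in>I. Ys i) a (step_fun (\<Union>i\<in>I. Ys i) \<theta> Y')) (Ys i) =
      fun_add (Ys i) (restrict a (Ys i)) (step_fun (Ys i) \<theta> (Y' \<inter> Ys i))"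
    using i(1) by (auto simp: fun_eq_iff fun_add_def step_fun_def)
  then show ?thesis
    using i by (auto simp: primal_at_def non_one_def disjoint_union_map_apply[OF disj i])
qed

text \<open>The thresholds of the union and of its blocks may differ. \<open>primal_iff_at\<close>
  replaces them by the existence of a positive step, and the blocks agree with the union for each
  step.\<close>

lemma primal_disjoint_union:
  assumes I: "finite I" and fs: "\<And>i. i \<in> I \<Longrightarrow> non_expansive (Ys i) (Zs i) (fs i)"
    and fin: "\<And>i. i \<in> I \<Longrightarrow> finite (Ys i)" "\<And>i. i \<in> I \<Longrightarrow> finite (Zs i)"
    and disj: "disjoint_family_on Zs I"
    and a: "a \<in> mv_space (\<Union>i\<in>I. Ys i)" and Y': "Y' \<subseteq> non_one (\<Union>i\<in>I. Ys i) a"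
  shows "primal (\<Union>i\<in>I. Ys i) (\<Union>i\<in>I. Zs i) (disjoint_union_map I Ys Zs fs) a Y' =
    (\<Union>i\<in>I. primal (Ys i) (Zs i) (fs i) (restrict a (Ys i)) (Y' \<inter> Ys i))"
proof -
  let ?f = "disjoint_union_map I Ys Zs fs"
  let ?P = "primal (\<Union>i\<in>I. Ys i) (\<Union>i\<in>I. Zs i) ?f a Y'"
  let ?Q = "\<lambda>i. primal (Ys i) (Zs i) (fs i) (restrict a (Ys i)) (Y' \<inter> Ys i)"
  have finU: "finite (\<Union>i\<in>I. Ys i)" "finite (\<Union>i\<in>I. Zs i)" using I fin by auto
  have ne: "non_expansive (\<Union>i\<in>I. Ys i) (\<Union>i\<in>I. Zs i) ?f"
    by (rule non_expansive_disjoint_union[OF I fs fin disj])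
  have iff: "z \<in> ?P \<longleftrightarrow> z \<in> ?Q i" if i: "i \<in> I" "z \<in> Zs i" for i z
  proof -
    have "Y' \<inter> Ys i \<subseteq> non_one (Ys i) (restrict a (Ys i))"
      using Y' by (auto simp: non_one_def)
    then have "z \<in> ?Q i \<longleftrightarrow>
        (\<exists>\<theta>>0. z \<in> primal_at (Ys i) (Zs i) (fs i) (restrict a (Ys i)) \<theta> (Y' \<inter> Ys i))"
      by (intro primal_iff_at[OF fs[OF i(1)] fin[OF i(1)]]) auto
    then show ?thesis
      by (simp only: primal_iff_at[OF ne finU a Y'] primal_at_disjoint_union[OF disj i])
  qed
  have P: "?P \<subseteq> (\<Union>i\<in>I. Zs i)" and Q: "?Q i \<subseteq> Zs i" for i
    by (auto simp: primal_def primal_at_def non_one_def)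
  show ?thesis
  proof (intro equalityI subsetI)
    fix z assume z: "z \<in> ?P"
    then obtain i where i: "i \<in> I" "z \<in> Zs i" using P by blast
    then have "z \<in> ?Q i" using iff[OF i] z by blast
    with i(1) show "z \<in> (\<Union>i\<in>I. ?Q i)" by (rule UN_I)
  next
    fix z assume "z \<in> (\<Union>i\<in>I. ?Q i)"
    then obtain i where i: "i \<in> I" "z \<in> ?Q i" by (rule UN_E)
    have "z \<in> Zs i" using Q i(2) by (rule subsetD)
    then show "z \<in> ?P" using iff[OF i(1)] i(2) by blast
  qed
qed

lemma dual_disjoint_union:
  assumes I: "finite I" and fs: "\<And>i. i \<in> I \<Longrightarrow> non_expansive (Ys i) (Zs i) (fs i)"
    and fin: "\<And>i. i \<in> I \<Longrightarrow> finite (Ys i)" "\<And>i. i \<in> I \<Longrightarrow> finite (Zs i)"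
    and disj: "disjoint_family_on Zs I"
    and a: "a \<in> mv_space (\<Union>i\<in>I. Ys i)" and Y': "Y' \<subseteq> non_zero (\<Union>i\<in>I. Ys i) a"
  shows "dual (\<Union>i\<in>I. Ys i) (\<Union>i\<in>I. Zs i) (disjoint_union_map I Ys Zs fs) a Y' =
    (\<Union>i\<in>I. dual (Ys i) (Zs i) (fs i) (restrict a (Ys i)) (Y' \<inter> Ys i))"
proof -
  let ?Y = "\<Union>i\<in>I. Ys i" and ?Z = "\<Union>i\<in>I. Zs i"
  let ?gs = "\<lambda>i. de_morgan (Ys i) (Zs i) (fs i)"
  have restr: "restrict (fun_neg ?Y b) (Ys i) = fun_neg (Ys i) (restrict b (Ys i))" if "i \<in> I" for i b
    using that by (auto simp: fun_eq_iff fun_neg_def)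
  have "de_morgan ?Y ?Z (disjoint_union_map I Ys Zs fs) b = disjoint_union_map I Ys Zs ?gs b"
    if "b \<in> mv_space ?Y" for b
  proof (rule PiE_ext[where k = ?Z and s = "\<lambda>_. UNIV"])
    fix z assume "z \<in> ?Z"
    then obtain i where i: "i \<in> I" "z \<in> Zs i" by blast
    then show "de_morgan ?Y ?Z (disjoint_union_map I Ys Zs fs) b z = disjoint_union_map I Ys Zs ?gs b z"
      using \<open>z \<in> ?Z\<close>
      by (simp only: de_morgan_def fun_neg_app disjoint_union_map_apply[OF disj i] restr)
  qed (simp_all add: de_morgan_def)
  then have "primal ?Y ?Z (de_morgan ?Y ?Z (disjoint_union_map I Ys Zs fs)) (fun_neg ?Y a) =
      primal ?Y ?Z (disjoint_union_map I Ys Zs ?gs) (fun_neg ?Y a)"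
    by (intro primal_cong) auto
  moreover have "primal ?Y ?Z (disjoint_union_map I Ys Zs ?gs) (fun_neg ?Y a) Y' =
      (\<Union>i\<in>I. primal (Ys i) (Zs i) (?gs i) (restrict (fun_neg ?Y a) (Ys i)) (Y' \<inter> Ys i))"
    using Y' by (intro primal_disjoint_union I fin disj non_expansive_de_morgan fs) auto
  moreover have "dual (Ys i) (Zs i) (fs i) (restrict a (Ys i)) =
      primal (Ys i) (Zs i) (?gs i) (restrict (fun_neg ?Y a) (Ys i))" if "i \<in> I" for i
    unfolding restr[OF that] by (rule dual_eq_primal) simp
  ultimately show ?thesis by (simp add: dual_eq_primal[OF a])
qed

theorem theorem5p2:
  fixes Y :: "'y set" and Z :: "'z set" and W :: "'w set"
  assumes "finite Y" and "finite Z" and "finite W"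
  shows
   "(\<comment> \<open>(1) constant\<close>
     \<forall>k \<in> (mv_space Z :: ('z \<Rightarrow> 'm::complete_mv_chain) set).
       non_expansive Y Z (const_map k) \<and>
       (\<forall>a\<in>mv_space Y.
          (\<forall>Y' \<subseteq> non_one Y a. primal Y Z (const_map k) a Y' = {}) \<and>
          (\<forall>Y' \<subseteq> non_zero Y a. dual Y Z (const_map k) a Y' = {})))
    \<and>
    (\<comment> \<open>(2) reindexing\<close>
     \<forall>u \<in> Z \<rightarrow> Y.
       non_expansive Y Z (reindex Z u :: ('y \<Rightarrow> 'm) \<Rightarrow> _) \<and>
       (\<forall>a \<in> (mv_space Y :: ('y \<Rightarrow> 'm) set).
          (\<forall>Y' \<subseteq> non_one Y a. primal Y Z (reindex Z u) a Y' = {z \<in> Z. u z \<in> Y'}) \<and>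
          (\<forall>Y' \<subseteq> non_zero Y a. dual Y Z (reindex Z u) a Y' = {z \<in> Z. u z \<in> Y'})))
    \<and>
    (\<comment> \<open>(3) minimum\<close>
     \<forall>R \<subseteq> Y \<times> Z.
       non_expansive Y Z (min_rel Z R :: ('y \<Rightarrow> 'm) \<Rightarrow> _) \<and>
       (\<forall>a \<in> (mv_space Y :: ('y \<Rightarrow> 'm) set).
          (\<forall>Y' \<subseteq> non_one Y a. primal Y Z (min_rel Z R) a Y' =
             {z \<in> non_one Z (min_rel Z R a). arg_min_set a {y \<in> Y. (y, z) \<in> R} \<subseteq> Y'}) \<and>
          (\<forall>Y' \<subseteq> non_zero Y a. dual Y Z (min_rel Z R) a Y' =
             {z \<in> non_zero Z (min_rel Z R a). arg_min_set a {y \<in> Y. (y, z) \<in> R} \<inter> Y' \<noteq> {}})))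
    \<and>
    (\<comment> \<open>(4) maximum\<close>
     \<forall>R \<subseteq> Y \<times> Z.
       non_expansive Y Z (max_rel Z R :: ('y \<Rightarrow> 'm) \<Rightarrow> _) \<and>
       (\<forall>a \<in> (mv_space Y :: ('y \<Rightarrow> 'm) set).
          (\<forall>Y' \<subseteq> non_one Y a. primal Y Z (max_rel Z R) a Y' =
             {z \<in> non_one Z (max_rel Z R a). arg_max_set a {y \<in> Y. (y, z) \<in> R} \<inter> Y' \<noteq> {}}) \<and>
          (\<forall>Y' \<subseteq> non_zero Y a. dual Y Z (max_rel Z R) a Y' =
             {z \<in> non_zero Z (max_rel Z R a). arg_max_set a {y \<in> Y. (y, z) \<in> R} \<subseteq> Y'})))
    \<and>
    (\<comment> \<open>(5) average\<close>
     \<forall>(prd :: 'm \<Rightarrow> 'm \<Rightarrow> 'm) (D :: ('y \<Rightarrow> 'm) set).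
       mv_product prd \<and> Y \<noteq> {} \<and> D \<subseteq> distributions Y \<and> finite D \<longrightarrow>
       non_expansive Y D (average prd Y D) \<and>
       (\<forall>a\<in>mv_space Y.
          (\<forall>Y' \<subseteq> non_one Y a. primal Y D (average prd Y D) a Y' =
             {p \<in> non_one D (average prd Y D a). supp Y p \<subseteq> Y'}) \<and>
          (\<forall>Y' \<subseteq> non_zero Y a. dual Y D (average prd Y D) a Y' =
             {p \<in> non_zero D (average prd Y D a). supp Y p \<subseteq> Y'})))
    \<and>
    (\<comment> \<open>(6) composition\<close>
     \<forall>(g :: ('y \<Rightarrow> 'm) \<Rightarrow> ('w \<Rightarrow> 'm)) (h :: ('w \<Rightarrow> 'm) \<Rightarrow> ('z \<Rightarrow> 'm)).
       non_expansive Y W g \<and> non_expansive W Z h \<longrightarrow>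
       non_expansive Y Z (h \<circ> g) \<and>
       (\<forall>a\<in>mv_space Y.
          (\<forall>Y' \<subseteq> non_one Y a.
             primal Y Z (h \<circ> g) a Y' = (primal W Z h (g a) \<circ> primal Y W g a) Y') \<and>
          (\<forall>Y' \<subseteq> non_zero Y a.
             dual Y Z (h \<circ> g) a Y' = (dual W Z h (g a) \<circ> dual Y W g a) Y')))
    \<and>
    (\<comment> \<open>(7) disjoint union\<close>
     \<forall>(I :: 'i set) (Ys :: 'i \<Rightarrow> 'y set) (Zs :: 'i \<Rightarrow> 'z set)
       (fs :: 'i \<Rightarrow> ('y \<Rightarrow> 'm) \<Rightarrow> ('z \<Rightarrow> 'm)).
       finite I \<and> (\<forall>i\<in>I. finite (Ys i) \<and> finite (Zs i) \<and> non_expansive (Ys i) (Zs i) (fs i)) \<and>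
       disjoint_family_on Zs I \<longrightarrow>
       (let YU = (\<Union>i\<in>I. Ys i); ZU = (\<Union>i\<in>I. Zs i); f = disjoint_union_map I Ys Zs fs in
        non_expansive YU ZU f \<and>
        (\<forall>a\<in>mv_space YU.
           (\<forall>Y' \<subseteq> non_one YU a. primal YU ZU f a Y' =
              (\<Union>i\<in>I. primal (Ys i) (Zs i) (fs i) (restrict a (Ys i)) (Y' \<inter> Ys i))) \<and>
           (\<forall>Y' \<subseteq> non_zero YU a. dual YU ZU f a Y' =
              (\<Union>i\<in>I. dual (Ys i) (Zs i) (fs i) (restrict a (Ys i)) (Y' \<inter> Ys i))))))"
proof (intro conjI, goal_cases)
  case 1
  show ?case
    using assms by (intro ballI conjI allI impI non_expansive_const primal_const dual_const)
next
  case 2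
  show ?case
    using assms by (intro ballI conjI allI impI non_expansive_reindex primal_reindex dual_reindex)
next
  case 3
  show ?case
    using assms by (intro ballI conjI allI impI non_expansive_min primal_min dual_min)
next
  case 4
  show ?case
    using assms by (intro ballI conjI allI impI non_expansive_max primal_max dual_max)
next
  case 5
  show ?case
  proof (intro allI impI, elim conjE)
    fix prd :: "'m \<Rightarrow> 'm \<Rightarrow> 'm" and D :: "('y \<Rightarrow> 'm) set"
    assume "mv_product prd" and D: "Y \<noteq> {}" "D \<subseteq> distributions Y" "finite D"
    then interpret mv_product prd by simp
    show "non_expansive Y D (average prd Y D) \<and>
       (\<forall>a\<in>mv_space Y.
          (\<forall>Y' \<subseteq> non_one Y a. primal Y D (average prd Y D) a Y' =
             {p \<in> non_one D (average prd Y D a). supp Y p \<subseteq> Y'}) \<and>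
          (\<forall>Y' \<subseteq> non_zero Y a. dual Y D (average prd Y D) a Y' =
             {p \<in> non_zero D (average prd Y D a). supp Y p \<subseteq> Y'}))"
      using assms D
      by (intro ballI conjI allI impI non_expansive_average primal_average dual_average)
  qed
next
  case 6
  show ?case
    using assms
    by (simp add: non_expansive_comp[of Y W _ Z] primal_comp[of Y W _ Z] dual_comp[of Y W _ Z])
next
  case 7
  show ?case
    unfolding Let_def
    by (intro ballI conjI allI impI non_expansive_disjoint_union primal_disjoint_union
        dual_disjoint_union) simp_all
qed

end
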